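(* For each of the following graph classes $\mathcal{C}$ there exists an online coloring algorithm with predictions (which knows that the input lies in $\mathcal{C}$) such that for every online graph with predictions $(G,\pi,P)$ with $G\in\mathcal{C}$ on $n$ vertices, the ratio of the number of colors used to $\chi(G)$ is $1$ if $\eta(G)=0$, and at most $3\min\{\eta(G)/2+1,\,X\}$ otherwise, where: (i) $\mathcal{C}$ = bipartite graphs and $X=X(n)$ is a function with $X(n)=\Theta(\log n)$; (ii) $\mathcal{C}$ = $P_6$-free bipartite graphs and $X=\chi_{OL}(G)-\tfrac12$; (iii) $\mathcal{C}$ = $P_7$-free bipartite graphs and $X=2\chi_{OL}(G)-\tfrac12$; (iv) $\mathcal{C}$ = $P_8$-free bipartite graphs and $X=\tfrac{3(\chi_{OL}(G)+1)^2}{2}$; (v) $\mathcal{C}$ = $P_9$-free bipartite graphs and $X=3(\chi_{OL}(G)+1)^2$.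
   Context: An online graph with predictions $(G,\pi,P)$ consists of a finite graph $G=(V,E)$, an ordering $\pi$ of $V$ in which vertices are revealed one by one (with adjacencies to earlier vertices), and a map $P:V\to\mathcal{U}$ of predicted colors revealed with the vertices; an online coloring algorithm must irrevocably assign each arriving vertex a color so that the coloring is proper, using only the information revealed so far. $\chi(G)$ is the chromatic number. The prediction error is $\eta(G)=\min_O|\{v:P(v)\ne O(v)\}|$, the minimum over all proper colorings $O:V\to\mathcal{U}$ using exactly $\chi(G)$ colors. A graph is $P_k$-free if it contains no induced path on $k$ vertices. For a classical online algorithm $A$ (no predictions), $\chi_A(G)=\max_\pi$ (number of colors $A$ uses on $(G,\pi)$), and the online chromatic number is $\chi_{OL}(G)=\min_A\chi_A(G)$ over all online coloring algorithms $A$.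
   Formalization: In (ii), X = χ_OL(G) − 1/2 is used only for graphs with an edge, and X = 1 for edgeless graphs, where the stated bound is false (two isolated vertices with different predictions); graphs are taken nonempty and the color universe U infinite. *)

theory Defs
  imports Complex_Main "HOL-Library.Landau_Symbols" "HOL-Combinatorics.Multiset_Permutations"
begin

record 'v graph =
  verts :: "'v set"
  edges :: "'v set set"

text \<open>Graphs are simple, finite and have at least one vertex, so that dividing by the
  chromatic number makes sense.\<close>

definition finite_graph :: "'v graph \<Rightarrow> bool" where
  "finite_graph G \<longleftrightarrow> finite (verts G) \<and> verts G \<noteq> {} \<and>
     (\<forall>e\<in>edges G. e \<subseteq> verts G \<and> card e = 2)"

definition proper_coloring :: "'v graph \<Rightarrow> ('v \<Rightarrow> 'c) \<Rightarrow> bool" where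
  "proper_coloring G f \<longleftrightarrow> (\<forall>u v. {u, v} \<in> edges G \<longrightarrow> f u \<noteq> f v)"

definition num_colors :: "'v graph \<Rightarrow> ('v \<Rightarrow> 'c) \<Rightarrow> nat" where
  "num_colors G f = card (f ` verts G)"

definition chromatic_number :: "'v graph \<Rightarrow> nat" where
  "chromatic_number G = (LEAST k. \<exists>f :: 'v \<Rightarrow> nat. proper_coloring G f \<and> num_colors G f = k)"

definition bipartite :: "'v graph \<Rightarrow> bool" where
  "bipartite G \<longleftrightarrow> (\<exists>S T. S \<union> T = verts G \<and> S \<inter> T = {} \<and>
     (\<forall>e\<in>edges G. \<exists>s\<in>S. \<exists>t\<in>T. e = {s, t}))"

definition induced_path :: "'v graph \<Rightarrow> 'v list \<Rightarrow> bool" where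
  "induced_path G p \<longleftrightarrow> distinct p \<and> set p \<subseteq> verts G \<and>
     (\<forall>i<length p. \<forall>j<length p. {p ! i, p ! j} \<in> edges G \<longleftrightarrow> i = Suc j \<or> j = Suc i)"

definition path_free :: "nat \<Rightarrow> 'v graph \<Rightarrow> bool" where
  "path_free k G \<longleftrightarrow> \<not> (\<exists>p. length p = k \<and> induced_path G p)"

definition bipartite_graphs :: "'v graph set" where
  "bipartite_graphs = {G. finite_graph G \<and> bipartite G}"

definition path_free_bipartite_graphs :: "nat \<Rightarrow> 'v graph set" where
  "path_free_bipartite_graphs k = {G \<in> bipartite_graphs. path_free k G}"

text \<open>A deterministic online algorithm maps the history up to and including the current vertex
  to the color of that vertex. The history has one entry per revealed vertex: the positions
  (in order of arrival) of its earlier neighbors, and its prediction. In particular the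
  algorithm does not see the names of the vertices; otherwise it could recognise the vertices
  of a fixed graph, and the online chromatic number would collapse to the chromatic number.
  The algorithm's own earlier decisions are determined by the history.\<close>

type_synonym ('p, 'c) online_algorithm = "(nat set \<times> 'p) list \<Rightarrow> 'c"

definition history :: "'v graph \<Rightarrow> ('v \<Rightarrow> 'p) \<Rightarrow> 'v list \<Rightarrow> (nat set \<times> 'p) list" where
  "history G P vs =
     map (\<lambda>i. ({j. j < i \<and> {vs ! j, vs ! i} \<in> edges G}, P (vs ! i))) [0..<length vs]"

definition online_coloring ::
  "('p, 'c) online_algorithm \<Rightarrow> 'v graph \<Rightarrow> 'v list \<Rightarrow> ('v \<Rightarrow> 'p) \<Rightarrow> 'v \<Rightarrow> 'c" where
  "online_coloring A G \<pi> P v = A (history G P (takeWhile (\<lambda>u. u \<noteq> v) \<pi> @ [v]))"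

text \<open>The set \<open>\<C>\<close> is the class of graphs the algorithm may rely on the input belonging to.\<close>

definition online_coloring_algorithm ::
  "'v graph set \<Rightarrow> ('p, 'c) online_algorithm \<Rightarrow> bool" where
  "online_coloring_algorithm \<C> A \<longleftrightarrow>
     (\<forall>G\<in>\<C>. \<forall>\<pi>\<in>permutations_of_set (verts G). \<forall>P. proper_coloring G (online_coloring A G \<pi> P))"

text \<open>Classical online algorithms, without predictions, get the trivial prediction of type
  \<^typ>\<open>unit\<close>.\<close>

definition algorithm_chromatic_number :: "(unit, nat) online_algorithm \<Rightarrow> 'v graph \<Rightarrow> nat" where
  "algorithm_chromatic_number A G =
     Max ((\<lambda>\<pi>. num_colors G (online_coloring A G \<pi> (\<lambda>_. ()))) ` permutations_of_set (verts G))"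

definition online_chromatic_number :: "'v graph \<Rightarrow> nat" where
  "online_chromatic_number G =
     (LEAST k. \<exists>A. online_coloring_algorithm {H :: 'v graph. finite_graph H} A \<and>
        algorithm_chromatic_number A G = k)"

definition prediction_error :: "'v graph \<Rightarrow> ('v \<Rightarrow> 'c) \<Rightarrow> nat" where
  "prediction_error G P =
     (LEAST m. \<exists>f :: 'v \<Rightarrow> 'c. proper_coloring G f \<and> num_colors G f = chromatic_number G \<and>
        card {v \<in> verts G. P v \<noteq> f v} = m)"

definition color_ratio ::
  "('c, 'c) online_algorithm \<Rightarrow> 'v graph \<Rightarrow> 'v list \<Rightarrow> ('v \<Rightarrow> 'c) \<Rightarrow> real" where
  "color_ratio A G \<pi> P =
     real (num_colors G (online_coloring A G \<pi> P)) / real (chromatic_number G)"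

definition ratio_guarantee ::
  "'v graph set \<Rightarrow> ('v graph \<Rightarrow> real) \<Rightarrow> ('c, 'c) online_algorithm \<Rightarrow> bool" where
  "ratio_guarantee \<C> X A \<longleftrightarrow>
     (\<forall>G\<in>\<C>. \<forall>\<pi>\<in>permutations_of_set (verts G). \<forall>P.
        (prediction_error G P = 0 \<longrightarrow> color_ratio A G \<pi> P = 1) \<and>
        (prediction_error G P \<noteq> 0 \<longrightarrow>
           color_ratio A G \<pi> P \<le> 3 * min (real (prediction_error G P) / 2 + 1) (X G)))"

text \<open>For \<open>P\<^sub>6\<close>-free graphs the value is the online chromatic number minus one half as soon as
  the graph has an edge. On edgeless graphs that value is one half, which no algorithm can
  attain together with ratio 1 for error 0: two isolated vertices with different predictions
  must get different colors, since they may turn out to be the ends of a path on four vertices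
  with a correct prediction. There we use \<open>1\<close>, which is \<open>(2 \<chi>\<^sub>O\<^sub>L - 1) / \<chi>\<close>; for graphs with an
  edge (\<open>\<chi> = 2\<close>) that same quotient is \<open>\<chi>\<^sub>O\<^sub>L - 1/2\<close>.\<close>

definition P6_free_value :: "'v graph \<Rightarrow> real" where
  "P6_free_value G =
     (if edges G = {} then 1 else real (online_chromatic_number G) - 1 / 2)"

end

theory Submission
  imports Defs
begin

text \<open>
  The algorithm colors each vertex either by first fit inside its prediction class, which costs at most
  \<open>\<chi> + \<eta>\<close> colors, or by a variant of the classical online algorithm that keeps a bipartition of every
  component and opens a new pair of colors only when two components with conflicting orientations merge.
  Switching between the two according to the numbers of colors used so far costs a factor of three.

  For the second algorithm, each new pair of colors doubles a binary tree of merges, so that there are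
  \<open>O(log n)\<close> of them. To compare with the online chromatic number, the orientation of a component is chosen
  by the number of colors that an adversary can force on either side. As long as no merge increases this number,
  all components in the merge tree are ties. If a merging vertex \<open>x\<close> of a graph without induced path on nine
  vertices missed a previous merging vertex of the opposite side in both merged components, there would be
  induced paths on five vertices from \<open>x\<close> into each of them. So \<open>x\<close> is complete to the previous merging vertices
  of one component, which after linearly many merges lets the adversary force another color.
\<close>

section \<open>Forcing structures and online games\<close>

text \<open>The online chromatic number belongs to the single graph \<open>G\<close>, so an
  adversary may present only induced subgraphs of \<open>G\<close>. He needs pieces inside
  \<open>G\<close> for every possible reaction of the algorithm; \<open>forcing\<close> is the
  recursive record of such pieces. The bicoloring evaluates the same predicate on the component it
  sees, and this is what ties its votes to the lower bound. Origin of the constants: two induced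
  paths with m and n vertices that share only their first vertex, and lead into anticomplete sets,
  join to an induced path on m + n - 1 vertices. Legs of 4 and 3, 4 and 4, 5 and 5 vertices thus
  exclude each other when 6, 7 or 9 vertices are forbidden. If j colors are already forced, one more
  costs 2, 3 or 2 j + 3 levels of the merge tree. With k the online chromatic number, this sums to
  at most 2 k - 1, 3 k - 2 or k^2 + 4 k indices, each carrying two colors. A bicoloring with at most
  4 X colors and chromatic number 2 then yields the ratio 3 X after switching.\<close>

definition anticomplete :: "('a \<Rightarrow> 'a \<Rightarrow> bool) \<Rightarrow> 'a set \<Rightarrow> 'a set \<Rightarrow> bool" where
  "anticomplete E X Y \<longleftrightarrow> X \<inter> Y = {} \<and> (\<forall>u\<in>X. \<forall>v\<in>Y. \<not> E u v \<and> \<not> E v u)"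

lemma anticomplete_mono:
  "anticomplete E X Y \<Longrightarrow> X' \<subseteq> X \<Longrightarrow> Y' \<subseteq> Y \<Longrightarrow> anticomplete E X' Y'"
  unfolding anticomplete_def by blast

lemma anticomplete_sym: "anticomplete E X Y \<Longrightarrow> anticomplete E Y X"
  unfolding anticomplete_def by blast

text \<open>If \<open>forcing E s k b T\<close>, an adversary playing inside \<open>T\<close> forces \<open>k\<close> colors on side \<open>b\<close>. He plays the
  strategy for \<open>k - 1\<close> colors twice. If the two color sets differ, he lets both copies live on side \<open>b\<close>
  (first conjunct); if they agree, he lets them live on opposite sides and presents \<open>x\<close> (second conjunct).\<close>

primrec forcing :: "('a \<Rightarrow> 'a \<Rightarrow> bool) \<Rightarrow> ('a \<Rightarrow> bool) \<Rightarrow> nat \<Rightarrow> bool \<Rightarrow> 'a set \<Rightarrow> bool" where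
  "forcing E s 0 b T \<longleftrightarrow> True"
| "forcing E s (Suc k) b T \<longleftrightarrow>
     (\<exists>T1 T2. T1 \<subseteq> T \<and> T2 \<subseteq> T \<and> anticomplete E T1 T2 \<and> forcing E s k b T1 \<and> forcing E s k b T2) \<and>
     (\<exists>x T1 T2. x \<in> T \<and> s x = b \<and> T1 \<subseteq> T \<and> T2 \<subseteq> T \<and> x \<notin> T1 \<and> x \<notin> T2 \<and> anticomplete E T1 T2 \<and>
        forcing E s k b T1 \<and> forcing E s k (\<not> b) T2 \<and> (\<forall>u\<in>T1 \<union> T2. s u \<noteq> b \<longrightarrow> E x u))"

lemma forcing_SucI:
  assumes "T1 \<subseteq> T" "T2 \<subseteq> T" "anticomplete E T1 T2" "forcing E s k b T1" "forcing E s k b T2"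
    "x \<in> T" "s x = b" "U1 \<subseteq> T" "U2 \<subseteq> T" "x \<notin> U1" "x \<notin> U2" "anticomplete E U1 U2"
    "forcing E s k b U1" "forcing E s k (\<not> b) U2" "\<forall>u\<in>U1 \<union> U2. s u \<noteq> b \<longrightarrow> E x u"
  shows "forcing E s (Suc k) b T"
  unfolding forcing.simps
  by (rule conjI, rule exI[of _ T1], rule exI[of _ T2], intro conjI assms,
      rule exI[of _ x], rule exI[of _ U1], rule exI[of _ U2], intro conjI assms)

lemma forcing_SucE:
  assumes "forcing E s (Suc k) b T"
  obtains T1 T2 x U1 U2 where
    "T1 \<subseteq> T" "T2 \<subseteq> T" "anticomplete E T1 T2" "forcing E s k b T1" "forcing E s k b T2"
    "x \<in> T" "s x = b" "U1 \<subseteq> T" "U2 \<subseteq> T" "x \<notin> U1" "x \<notin> U2" "anticomplete E U1 U2"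
    "forcing E s k b U1" "forcing E s k (\<not> b) U2" "\<forall>u\<in>U1 \<union> U2. s u \<noteq> b \<longrightarrow> E x u"
proof -
  from conjunct1[OF assms[unfolded forcing.simps]] obtain T1 T2 where 1: "T1 \<subseteq> T" "T2 \<subseteq> T"
    "anticomplete E T1 T2" "forcing E s k b T1" "forcing E s k b T2" by (elim exE conjE) (rule that)
  from conjunct2[OF assms[unfolded forcing.simps]] obtain x U1 U2 where 2: "x \<in> T" "s x = b" "U1 \<subseteq> T" "U2 \<subseteq> T"
    "x \<notin> U1" "x \<notin> U2" "anticomplete E U1 U2" "forcing E s k b U1" "forcing E s k (\<not> b) U2"
    "\<forall>u\<in>U1 \<union> U2. s u \<noteq> b \<longrightarrow> E x u" by (elim exE conjE) (rule that)
  show ?thesis by (rule that[OF 1 2])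
qed

declare forcing.simps(2) [simp del]

lemma forcing_mono:
  assumes "forcing E s k b T" "T \<subseteq> T'"
  shows "forcing E s k b T'"
proof (cases k)
  case (Suc j)
  with assms(1) have "forcing E s (Suc j) b T" by simp
  then obtain T1 T2 x U1 U2 where
    "T1 \<subseteq> T" "T2 \<subseteq> T" "anticomplete E T1 T2" "forcing E s j b T1" "forcing E s j b T2"
    "x \<in> T" "s x = b" "U1 \<subseteq> T" "U2 \<subseteq> T" "x \<notin> U1" "x \<notin> U2" "anticomplete E U1 U2"
    "forcing E s j b U1" "forcing E s j (\<not> b) U2" "\<forall>u\<in>U1 \<union> U2. s u \<noteq> b \<longrightarrow> E x u" by (rule forcing_SucE)
  then show ?thesis using assms(2) unfolding Suc
    by (intro forcing_SucI[of T1 T' T2 E s j b x U1 U2]) auto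
qed simp

lemma forcing_SucD:
  assumes "forcing E s (Suc k) b T"
  shows "forcing E s k b T"
proof -
  from assms obtain T1 where "T1 \<subseteq> T" "forcing E s k b T1" by (rule forcing_SucE)
  then show ?thesis by (rule forcing_mono[rotated])
qed

lemma forcing_antimono:
  assumes "forcing E s k b T" "j \<le> k"
  shows "forcing E s j b T"
  using assms(2,1) by (induction rule: inc_induct) (auto intro: forcing_SucD)

text \<open>Only the comparisons of \<open>s\<close> with \<open>b\<close> matter, so sides may be
  renamed. This lets the algorithm work with sides relative to the newest vertex, without knowing
  \<open>s\<close>.\<close>

lemma forcing_cong:
  assumes "\<And>u v. u \<in> T \<Longrightarrow> v \<in> T \<Longrightarrow> E u v = E' u v"
    and "\<And>u. u \<in> T \<Longrightarrow> (s u = b) = (s' u = b')"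
  shows "forcing E s k b T = forcing E' s' k b' T"
proof -
  have "forcing E s k b T \<Longrightarrow> forcing E' s' k b' T"
    if "\<And>u v. u \<in> T \<Longrightarrow> v \<in> T \<Longrightarrow> E u v = E' u v"
      and "\<And>u. u \<in> T \<Longrightarrow> (s u = b) = (s' u = b')"
    for E E' :: "'a \<Rightarrow> 'a \<Rightarrow> bool" and s s' b b' T
    using that
  proof (induction k arbitrary: b b' T)
    case (Suc k)
    have IH: "forcing E' s' k c' T1"
      if "forcing E s k c T1" "T1 \<subseteq> T" "c = b \<and> c' = b' \<or> c = (\<not> b) \<and> c' = (\<not> b')" for c c' T1
    proof (rule Suc.IH[OF that(1)])
      show "E u v = E' u v" if "u \<in> T1" "v \<in> T1" for u v using that \<open>T1 \<subseteq> T\<close> Suc.prems(2) by blast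
      show "(s u = c) = (s' u = c')" if "u \<in> T1" for u
        using that \<open>T1 \<subseteq> T\<close> Suc.prems(3)[of u] \<open>c = b \<and> c' = b' \<or> _\<close> by auto
    qed
    have anti: "anticomplete E' T1 T2" if "anticomplete E T1 T2" "T1 \<subseteq> T" "T2 \<subseteq> T" for T1 T2
      using that Suc.prems(2) unfolding anticomplete_def by (meson subsetD)
    from Suc.prems(1) obtain T1 T2 x U1 U2 where 1:
      "T1 \<subseteq> T" "T2 \<subseteq> T" "anticomplete E T1 T2" "forcing E s k b T1" "forcing E s k b T2"
      and 2: "x \<in> T" "s x = b" "U1 \<subseteq> T" "U2 \<subseteq> T" "x \<notin> U1" "x \<notin> U2" "anticomplete E U1 U2"
      "forcing E s k b U1" "forcing E s k (\<not> b) U2" "\<forall>u\<in>U1 \<union> U2. s u \<noteq> b \<longrightarrow> E x u"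
      by (rule forcing_SucE)
    show ?case
    proof (rule forcing_SucI[of T1 T T2 E' s' k b' x U1 U2])
      show "anticomplete E' T1 T2" "anticomplete E' U1 U2" using anti 1 2 by auto
      show "forcing E' s' k b' T1" "forcing E' s' k b' T2" "forcing E' s' k b' U1" "forcing E' s' k (\<not> b') U2"
        using IH 1 2 by auto
      have "E' x u" if "u \<in> U1 \<union> U2" "s' u \<noteq> b'" for u
      proof -
        have "u \<in> T" using that(1) 2(3,4) by auto
        then show ?thesis using that 2(1,10) Suc.prems(2,3) by metis
      qed
      then show "\<forall>u\<in>U1 \<union> U2. s' u \<noteq> b' \<longrightarrow> E' x u" by blast
      show "s' x = b'" using 2(1,2) Suc.prems(3) by blast
    qed (use 1 2 in auto)
  qed simp
  from this[of T E E' s b s' b'] this[of T E' E s' b' s b] assms show ?thesis by metis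
qed

lemma forcing_one: "v \<in> T \<Longrightarrow> s v = b \<Longrightarrow> forcing E s (Suc 0) b T"
  by (rule forcing_SucI[of "{}" T "{}" E s 0 b v "{}" "{}"]) (auto simp: anticomplete_def)

lemma forcing_oneD: "forcing E s (Suc 0) b T \<Longrightarrow> \<exists>v\<in>T. s v = b"
  by (erule forcing_SucE) auto

section \<open>Abstract histories and the adversary's game\<close>

definition hist :: "('a \<Rightarrow> 'a \<Rightarrow> bool) \<Rightarrow> 'a list \<Rightarrow> nat set list" where
  "hist E vs = map (\<lambda>i. {j. j < i \<and> E (vs ! j) (vs ! i)}) [0..<length vs]"

text \<open>Renumbers the back-references of a history that is played after \<open>m\<close> earlier
  vertices without edges to them.\<close>

definition shift :: "nat \<Rightarrow> nat set list \<Rightarrow> nat set list" where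
  "shift m h = map ((`) ((+) m)) h"

lemma length_hist [simp]: "length (hist E vs) = length vs"
  by (simp add: hist_def)

lemma length_shift [simp]: "length (shift m h) = length h"
  by (simp add: shift_def)

lemma take_shift: "take n (shift m h) = shift m (take n h)"
  by (simp add: shift_def take_map)

lemma shift_append: "shift m (h @ h') = shift m h @ shift m h'"
  by (simp add: shift_def)

lemma shift_shift: "shift m (shift n h) = shift (m + n) h"
  by (simp add: shift_def image_image add.assoc)

lemma shift_0 [simp]: "shift 0 h = h"
proof -
  have "(`) ((+) (0 :: nat)) = id" by (auto simp: fun_eq_iff)
  then show ?thesis by (simp add: shift_def)
qed

lemma hist_nth: "i < length vs \<Longrightarrow> hist E vs ! i = {j. j < i \<and> E (vs ! j) (vs ! i)}"
  by (simp add: hist_def)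

lemma hist_take: "hist E (take n vs) = take n (hist E vs)"
  by (rule nth_equalityI) (auto simp: hist_nth)

lemma hist_snoc: "hist E (vs @ [x]) = hist E vs @ [{j. j < length vs \<and> E (vs ! j) x}]"
  by (rule nth_equalityI) (auto simp: hist_nth nth_append less_Suc_eq)

lemma hist_append:
  assumes "\<And>u v. u \<in> set us \<Longrightarrow> v \<in> set vs \<Longrightarrow> \<not> E u v"
  shows "hist E (us @ vs) = hist E us @ shift (length us) (hist E vs)"
  using assms
proof (induction vs rule: rev_induct)
  case (snoc x vs)
  have "{j. j < length (us @ vs) \<and> E ((us @ vs) ! j) x} = (+) (length us) ` {j. j < length vs \<and> E (vs ! j) x}"
  proof (intro equalityI subsetI)
    fix j assume j: "j \<in> {j. j < length (us @ vs) \<and> E ((us @ vs) ! j) x}"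
    have "\<not> j < length us"
      using j snoc.prems[of "us ! j" x] by (auto simp: nth_append)
    then show "j \<in> (+) (length us) ` {j. j < length vs \<and> E (vs ! j) x}"
      using j by (auto simp: nth_append intro!: image_eqI[of _ _ "j - length us"])
  qed (auto simp: nth_append)
  then show ?case
    using snoc by (simp add: hist_snoc[of E "us @ vs" x, simplified] hist_snoc shift_append del: append_assoc)
      (simp add: shift_def)
qed (simp add: shift_def hist_def)

lemma hist_map: "hist E (map f vs) = hist (\<lambda>u v. E (f u) (f v)) vs"
  by (rule nth_equalityI) (auto simp: hist_nth)

text \<open>Demanded for all histories, including those that embed into no particular graph: during
  the game it is still open where the presented vertices will lie.\<close>

definition proper_histories :: "(nat set list \<Rightarrow> 'c) \<Rightarrow> bool" where
  "proper_histories c \<longleftrightarrow>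
     (\<forall>h i j. i < length h \<longrightarrow> j < i \<longrightarrow> j \<in> h ! i \<longrightarrow> c (take (Suc j) h) \<noteq> c (take (Suc i) h))"

text \<open>The mask \<open>L\<close> marks the presented vertices that will lie on the designated
  side; \<open>h0\<close> is what was played before.\<close>

definition colors_at :: "(nat set list \<Rightarrow> 'c) \<Rightarrow> nat set list \<Rightarrow> nat set list \<Rightarrow> bool list \<Rightarrow> 'c set" where
  "colors_at c h0 h L = {c (h0 @ shift (length h0) (take (Suc i) h)) | i. i < length h \<and> L ! i}"

lemma finite_colors_at [simp]: "finite (colors_at c h0 h L)"
  unfolding colors_at_def by simp

lemma colors_at_append1:
  assumes "length L = length h"
  shows "colors_at c h0 h L \<subseteq> colors_at c h0 (h @ h') (L @ L')"
proof
  fix y assume "y \<in> colors_at c h0 h L"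
  then obtain i where "i < length h" "L ! i" "y = c (h0 @ shift (length h0) (take (Suc i) h))"
    unfolding colors_at_def by blast
  then show "y \<in> colors_at c h0 (h @ h') (L @ L')"
    unfolding colors_at_def using assms by (intro CollectI exI[of _ i]) (auto simp: nth_append)
qed

lemma colors_at_append2:
  assumes "length L = length h"
  shows "colors_at c (h0 @ shift (length h0) h) h' L' \<subseteq>
    colors_at c h0 (h @ shift (length h) h') (L @ L')"
proof
  fix y assume "y \<in> colors_at c (h0 @ shift (length h0) h) h' L'"
  then obtain i where "i < length h'" "L' ! i"
    "y = c ((h0 @ shift (length h0) h) @ shift (length (h0 @ shift (length h0) h)) (take (Suc i) h'))"
    unfolding colors_at_def by blast
  then show "y \<in> colors_at c h0 (h @ shift (length h) h') (L @ L')"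
    unfolding colors_at_def using assms
    by (intro CollectI exI[of _ "length h + i"])
      (auto simp: nth_append shift_append shift_shift take_shift Suc_diff_le)
qed

text \<open>The presented history does not depend on \<open>b\<close> and \<open>T\<close>: the embedding is chosen after the game.\<close>

lemma force_colors:
  fixes c :: "nat set list \<Rightarrow> nat"
  assumes "proper_histories c" and sym: "\<And>u v. E u v \<Longrightarrow> E v u" and bip: "\<And>u v. E u v \<Longrightarrow> s u \<noteq> s v"
  shows "\<exists>h L. length L = length h \<and> k \<le> card (colors_at c h0 h L) \<and>
    (\<forall>b T. forcing E s k b T \<longrightarrow> (\<exists>vs. length vs = length h \<and> distinct vs \<and> set vs \<subseteq> T \<and> hist E vs = h \<and>
       (\<forall>i<length vs. (s (vs ! i) = b) = L ! i)))"
proof (induction k arbitrary: h0)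
  case 0
  show ?case by (intro exI[of _ "[]"]) (auto simp: hist_def)
next
  case (Suc k)
  let ?real = "\<lambda>k h L. \<forall>b T. forcing E s k b T \<longrightarrow> (\<exists>vs. length vs = length h \<and> distinct vs \<and> set vs \<subseteq> T \<and>
       hist E vs = h \<and> (\<forall>i<length vs. (s (vs ! i) = b) = L ! i))"
  from Suc[of h0] obtain h1 L1 where 1: "length L1 = length h1" "k \<le> card (colors_at c h0 h1 L1)"
    and r1: "?real k h1 L1" by (elim exE conjE) (rule that)
  \<comment> \<open>The second copy is played on top of the first, hence the induction over
    arbitrary prefixes \<open>h0\<close>.\<close>
  let ?h0' = "h0 @ shift (length h0) h1"
  from Suc[of ?h0'] obtain h2 L2 where 2: "length L2 = length h2" "k \<le> card (colors_at c ?h0' h2 L2)"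
    and r2: "?real k h2 L2" by (elim exE conjE) (rule that)
  let ?K1 = "colors_at c h0 h1 L1" and ?K2 = "colors_at c ?h0' h2 L2"
  let ?h = "h1 @ shift (length h1) h2"
  show ?case
  proof (cases "Suc k \<le> card (?K1 \<union> ?K2)")
    case True
    have "?K1 \<union> ?K2 \<subseteq> colors_at c h0 ?h (L1 @ L2)"
      by (intro Un_least colors_at_append1[OF 1(1)] colors_at_append2[OF 1(1)])
    then have "card (?K1 \<union> ?K2) \<le> card (colors_at c h0 ?h (L1 @ L2))"
      by (intro card_mono) auto
    moreover have "?real (Suc k) ?h (L1 @ L2)"
    proof (intro allI impI)
      fix b T assume "forcing E s (Suc k) b T"
      then obtain T1 T2 where T: "T1 \<subseteq> T" "T2 \<subseteq> T" "anticomplete E T1 T2" "forcing E s k b T1" "forcing E s k b T2"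
        by (rule forcing_SucE)
      from r1 T(4) obtain us where us: "length us = length h1" "distinct us" "set us \<subseteq> T1" "hist E us = h1"
        "\<forall>i<length us. (s (us ! i) = b) = L1 ! i" by metis
      from r2 T(5) obtain vs where vs: "length vs = length h2" "distinct vs" "set vs \<subseteq> T2" "hist E vs = h2"
        "\<forall>i<length vs. (s (vs ! i) = b) = L2 ! i" by metis
      have "hist E (us @ vs) = hist E us @ shift (length us) (hist E vs)"
        using T(3) us(3) vs(3) unfolding anticomplete_def by (intro hist_append) blast
      moreover have "distinct (us @ vs)" using us vs T(3) unfolding anticomplete_def by auto
      moreover have "(s ((us @ vs) ! i) = b) = (L1 @ L2) ! i" if "i < length (us @ vs)" for i
      proof (cases "i < length us")
        case False
        then have "i - length us < length vs" using that by auto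
        then show ?thesis using False us(1) vs(5) 1(1) by (simp add: nth_append)
      qed (use us 1(1) in \<open>simp add: nth_append\<close>)
      moreover have "length (us @ vs) = length ?h" "set (us @ vs) \<subseteq> T" using us vs T(1,2) by auto
      ultimately show "\<exists>vs. length vs = length ?h \<and> distinct vs \<and> set vs \<subseteq> T \<and>
         hist E vs = ?h \<and> (\<forall>i<length vs. (s (vs ! i) = b) = (L1 @ L2) ! i)"
        unfolding us(1,4) vs(4) by blast
    qed
    ultimately show ?thesis using True 1 2 by (intro exI[of _ ?h] exI[of _ "L1 @ L2"]) auto
  next
    case False
    then have "card (?K1 \<union> ?K2) \<le> k" by simp
    \<comment> \<open>Both sets have at least \<open>k\<close> elements and their union has at most
      \<open>k\<close>, so they coincide.\<close>
    then have "?K1 \<union> ?K2 = ?K1" "?K1 \<union> ?K2 = ?K2"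
      using 1(2) 2(2) card_seteq[of "?K1 \<union> ?K2" ?K1] card_seteq[of "?K1 \<union> ?K2" ?K2] by auto
    then have K: "?K1 = ?K2" by simp
    \<comment> \<open>The second copy is going to be realized with sides exchanged. The neighbors of
      the new vertex are therefore the unmarked vertices of the first copy and the marked ones of
      the second, and the latter carry all colors of \<open>?K2\<close>, which equals
      \<open>?K1\<close>.\<close>
    define N where "N = {j. j < length ?h \<and> (if j < length h1 then \<not> L1 ! j else L2 ! (j - length h1))}"
    define L where "L = L1 @ map Not L2 @ [True]"
    let ?hx = "?h @ [N]"
    let ?g = "h0 @ shift (length h0) ?hx"
    define cx where "cx = c ?g"
    have "cx \<notin> ?K2"
    proof
      assume "cx \<in> ?K2"
      then obtain i where i: "i < length h2" "L2 ! i" and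
        cx: "cx = c (?h0' @ shift (length ?h0') (take (Suc i) h2))"
        unfolding colors_at_def by blast
      let ?i = "length h0 + (length h1 + i)" and ?x = "length h0 + length ?h"
      have "length h1 + i \<in> N" using i by (auto simp: N_def)
      then have "?i \<in> ?g ! ?x" by (auto simp: nth_append shift_def)
      then have "c (take (Suc ?i) ?g) \<noteq> c (take (Suc ?x) ?g)"
        using assms(1)[unfolded proper_histories_def, rule_format, of ?x ?g ?i] i by simp
      moreover have "take (Suc ?x) ?g = ?g" by simp
      moreover have "take (Suc ?i) ?g = ?h0' @ shift (length ?h0') (take (Suc i) h2)"
        using i by (auto simp: shift_append take_shift shift_shift Suc_diff_le)
      ultimately show False using cx by (simp add: cx_def)
    qed
    moreover have "?K1 \<subseteq> colors_at c h0 ?hx L"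
      unfolding L_def append_assoc by (rule colors_at_append1[OF 1(1)])
    moreover have "cx \<in> colors_at c h0 ?hx L"
      unfolding colors_at_def cx_def using 1 2
      by (intro CollectI exI[of _ "length ?h"]) (auto simp: L_def nth_append)
    ultimately have "insert cx ?K1 \<subseteq> colors_at c h0 ?hx L" "cx \<notin> ?K1" using K by auto
    then have "Suc (card ?K1) \<le> card (colors_at c h0 ?hx L)"
      by (metis card_insert_disjoint card_mono finite_colors_at)
    then have "Suc k \<le> card (colors_at c h0 ?hx L)" using 1 by simp
    moreover have "?real (Suc k) ?hx L"
    proof (intro allI impI)
      fix b T assume "forcing E s (Suc k) b T"
      then obtain x T1 T2 where T: "x \<in> T" "s x = b" "T1 \<subseteq> T" "T2 \<subseteq> T" "x \<notin> T1" "x \<notin> T2"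
        "anticomplete E T1 T2" "forcing E s k b T1" "forcing E s k (\<not> b) T2"
        "\<forall>u\<in>T1 \<union> T2. s u \<noteq> b \<longrightarrow> E x u" by (rule forcing_SucE)
      show "\<exists>vs. length vs = length ?hx \<and> distinct vs \<and> set vs \<subseteq> T \<and>
         hist E vs = ?hx \<and> (\<forall>i<length vs. (s (vs ! i) = b) = L ! i)"
      proof -
        from r1 T(8) obtain us where us: "length us = length h1" "distinct us" "set us \<subseteq> T1" "hist E us = h1"
          "\<forall>i<length us. (s (us ! i) = b) = L1 ! i" by metis
        \<comment> \<open>Here the exchange happens: the mask \<open>L2\<close> now marks the side
          opposite to \<open>b\<close>.\<close>
        from r2 T(9) obtain vs where vs: "length vs = length h2" "distinct vs" "set vs \<subseteq> T2" "hist E vs = h2"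
          "\<forall>i<length vs. (s (vs ! i) = (\<not> b)) = L2 ! i" by metis
        have h: "hist E (us @ vs) = ?h"
          unfolding us(4)[symmetric] vs(4)[symmetric] length_hist
          using T(7) us(3) vs(3) unfolding anticomplete_def by (intro hist_append) blast
        have adj: "E u x \<longleftrightarrow> s u \<noteq> b" if "u \<in> set (us @ vs)" for u
          using that T(2,10) us(3) vs(3) sym bip by (metis UnCI UnE set_append subsetD)
        have iff: "E ((us @ vs) ! j) x \<longleftrightarrow> j \<in> N" if "j < length (us @ vs)" for j
        proof (cases "j < length us")
          case True
          then show ?thesis using us(1,5) adj[OF nth_mem[OF that]] by (simp add: N_def nth_append)
        next
          case False
          then have "j - length us < length vs" using that by auto
          then show ?thesis using False us(1) vs(1,5) adj[OF nth_mem[OF that]] by (auto simp: N_def nth_append)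
        qed
        have "j < length (us @ vs)" if "j \<in> N" for j using that us(1) vs(1) by (simp add: N_def)
        with iff have "{j. j < length (us @ vs) \<and> E ((us @ vs) ! j) x} = N" by blast
        then have "hist E ((us @ vs) @ [x]) = ?hx" unfolding hist_snoc h by simp
        moreover have "distinct ((us @ vs) @ [x])" using us(2,3) vs(2,3) T(5-7) unfolding anticomplete_def by auto
        moreover have "(s (((us @ vs) @ [x]) ! i) = b) = L ! i" if i: "i < length ((us @ vs) @ [x])" for i
        proof -
          consider "i < length us" | "\<not> i < length us" "i - length us < length vs" | "i = length (us @ vs)"
            using i by (cases "i < length us"; cases "i = length (us @ vs)") auto
          then show ?thesis
            by cases (use us(1,5) vs(1,5) 1(1) 2(1) T(2) in \<open>auto simp: L_def nth_append\<close>)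
        qed
        moreover have "length ((us @ vs) @ [x]) = length ?hx" "set ((us @ vs) @ [x]) \<subseteq> T"
          using us(1,3) vs(1,3) T(1,3,4) by auto
        ultimately show ?thesis by blast
      qed
    qed
    ultimately show ?thesis using 1 2 by (intro exI[of _ ?hx] exI[of _ L]) (auto simp: L_def)
  qed
qed

section \<open>A lower bound for the online chromatic number\<close>

text \<open>An online algorithm sees arrival positions, not names, so from here on the vertices are
  natural numbers in order of arrival.\<close>

definition arrival_graph :: "'v graph \<Rightarrow> 'v list \<Rightarrow> nat \<Rightarrow> nat \<Rightarrow> bool" where
  "arrival_graph G \<pi> i j \<longleftrightarrow> i < length \<pi> \<and> j < length \<pi> \<and> {\<pi> ! i, \<pi> ! j} \<in> edges G"

lemma arrival_graph_sym: "arrival_graph G \<pi> i j \<Longrightarrow> arrival_graph G \<pi> j i"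
  by (auto simp: arrival_graph_def insert_commute)

lemma hist_cong:
  assumes "\<And>u v. u \<in> set vs \<Longrightarrow> v \<in> set vs \<Longrightarrow> E u v = E' u v"
  shows "hist E vs = hist E' vs"
  by (rule nth_equalityI) (auto simp: hist_nth assms)

lemma history_unit: "history G (\<lambda>_. ()) ws = map (\<lambda>X. (X, ())) (hist (\<lambda>u v. {u, v} \<in> edges G) ws)"
  by (auto simp: history_def hist_def)

lemma takeWhile_prefix:
  assumes "distinct \<pi>" "i < length \<pi>"
  shows "takeWhile (\<lambda>u. u \<noteq> \<pi> ! i) \<pi> @ [\<pi> ! i] = take (Suc i) \<pi>"
proof -
  have "takeWhile (\<lambda>u. u \<noteq> \<pi> ! i) \<pi> = take i \<pi>"
    using assms by (intro takeWhile_eq_take_P_nth) (auto simp: nth_eq_iff_index_eq)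
  then show ?thesis using assms by (simp add: take_Suc_conv_app_nth)
qed

lemma online_coloring_nth:
  assumes "distinct \<pi>" "i < length \<pi>"
  shows "online_coloring A G \<pi> P (\<pi> ! i) = A (history G P (take (Suc i) \<pi>))"
  unfolding online_coloring_def takeWhile_prefix[OF assms] ..

lemma permutation_extending:
  assumes "finite V" "distinct ws" "set ws \<subseteq> V"
  obtains vs where "ws @ vs \<in> permutations_of_set V"
proof -
  obtain vs where "set vs = V - set ws" "distinct vs" using assms(1) finite_distinct_list[of "V - set ws"] by auto
  then have "ws @ vs \<in> permutations_of_set V" using assms unfolding permutations_of_set_def by auto
  then show ?thesis using that by blast
qed

text \<open>Coloring by arrival time is always proper, so the \<open>LEAST\<close> ranges over a
  nonempty set.\<close>

lemma online_chromatic_number_attained: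
  fixes G :: "'v graph"
  obtains A where "online_coloring_algorithm {H :: 'v graph. finite_graph H} A"
    "algorithm_chromatic_number A G = online_chromatic_number G"
proof -
  let ?A = "\<lambda>h :: (nat set \<times> unit) list. length h"
  have "online_coloring_algorithm {H :: 'v graph. finite_graph H} ?A"
    unfolding online_coloring_algorithm_def proper_coloring_def
  proof (intro ballI allI impI)
    fix H :: "'v graph" and \<pi> u v and P :: "'v \<Rightarrow> unit"
    assume H: "H \<in> {H. finite_graph H}" and \<pi>: "\<pi> \<in> permutations_of_set (verts H)" and e: "{u, v} \<in> edges H"
    have \<pi>': "distinct \<pi>" "set \<pi> = verts H" using \<pi> by (auto simp: permutations_of_set_def)
    have "card {u, v} = 2" "{u, v} \<subseteq> verts H" using H e by (auto simp: finite_graph_def)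
    then have "u \<noteq> v" "u \<in> set \<pi>" "v \<in> set \<pi>" using \<pi>' by auto
    then obtain i j where "i < length \<pi>" "j < length \<pi>" "u = \<pi> ! i" "v = \<pi> ! j" "i \<noteq> j"
      by (metis in_set_conv_nth)
    then show "online_coloring ?A H \<pi> P u \<noteq> online_coloring ?A H \<pi> P v"
      using \<pi>'(1) by (simp add: online_coloring_nth history_def)
  qed
  then have "\<exists>k A. online_coloring_algorithm {H :: 'v graph. finite_graph H} A \<and> algorithm_chromatic_number A G = k"
    by blast
  then have "\<exists>A. online_coloring_algorithm {H :: 'v graph. finite_graph H} A \<and>
      algorithm_chromatic_number A G = online_chromatic_number G"
    unfolding online_chromatic_number_def by (rule LeastI_ex)
  then show ?thesis using that by blast
qed

text \<open>An algorithm that is proper on the single graph \<open>G\<close> is made proper on all abstract histories: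
  histories that do not embed into \<open>G\<close> get fresh odd colors.\<close>

lemma online_chromatic_number_ge:
  fixes G :: "'v graph"
  assumes G: "finite_graph G" and \<pi>: "\<pi> \<in> permutations_of_set (verts G)"
    and bip: "\<And>i j. arrival_graph G \<pi> i j \<Longrightarrow> s i \<noteq> s j"
    and forcing: "forcing (arrival_graph G \<pi>) s k b T" and T: "T \<subseteq> {..<length \<pi>}"
  shows "k \<le> online_chromatic_number G"
proof -
  let ?adj = "\<lambda>u v. {u, v} \<in> edges G"
  obtain A where A: "online_coloring_algorithm {H :: 'v graph. finite_graph H} A"
    and AG: "algorithm_chromatic_number A G = online_chromatic_number G"
    by (rule online_chromatic_number_attained)
  define emb where "emb h \<longleftrightarrow> (\<exists>ws. distinct ws \<and> set ws \<subseteq> verts G \<and> hist ?adj ws = h)" for h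
  define A' where "A' h = A (map (\<lambda>X. (X, ())) h)" for h
  define c where "c h = (if emb h then 2 * A' h else 2 * length h + 1)" for h
  have fin: "finite (verts G)" using G by (simp add: finite_graph_def)
  have A': "online_coloring A G (ws @ vs) (\<lambda>_. ()) (ws ! i) = A' (take (Suc i) (hist ?adj ws))"
    if "ws @ vs \<in> permutations_of_set (verts G)" "i < length ws" for ws vs i
  proof -
    have "online_coloring A G (ws @ vs) (\<lambda>_. ()) ((ws @ vs) ! i)
        = A (history G (\<lambda>_. ()) (take (Suc i) (ws @ vs)))"
      using that by (intro online_coloring_nth) (auto simp: permutations_of_set_def)
    then show ?thesis using that(2) by (simp add: A'_def history_unit hist_take[symmetric] nth_append)
  qed
  have "proper_histories c"
    unfolding proper_histories_def
  proof (intro allI impI)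
    fix h :: "nat set list" and i j assume ij: "i < length h" "j < i" "j \<in> h ! i"
    show "c (take (Suc j) h) \<noteq> c (take (Suc i) h)"
    proof (cases "emb (take (Suc i) h)")
      case True
      then obtain ws where ws: "distinct ws" "set ws \<subseteq> verts G" "hist ?adj ws = take (Suc i) h"
        unfolding emb_def by blast
      have len: "length ws = Suc i" using arg_cong[OF ws(3), of length] ij by simp
      have tj: "hist ?adj (take (Suc j) ws) = take (Suc j) h"
        unfolding hist_take ws(3) using ij by simp
      have "emb (take (Suc j) h)"
        unfolding emb_def using ws tj by (intro exI[of _ "take (Suc j) ws"]) (auto dest: in_set_takeD)
      \<comment> \<open>Completing \<open>ws\<close> to an arrival order of all of \<open>G\<close>
        makes the properness of \<open>A\<close> on \<open>G\<close> available.\<close>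
      moreover obtain vs where vs: "ws @ vs \<in> permutations_of_set (verts G)"
        using permutation_extending[OF fin ws(1,2)] .
      have "h ! i = hist ?adj ws ! i" unfolding ws(3) using ij by simp
      then have "{ws ! j, ws ! i} \<in> edges G" using ij len by (simp add: hist_nth)
      then have "online_coloring A G (ws @ vs) (\<lambda>_. ()) (ws ! j) \<noteq> online_coloring A G (ws @ vs) (\<lambda>_. ()) (ws ! i)"
        using A G vs unfolding online_coloring_algorithm_def proper_coloring_def by blast
      then have "A' (take (Suc j) h) \<noteq> A' (take (Suc i) h)"
        using ij len ws(3) by (simp add: A'[OF vs])
      ultimately show ?thesis using True by (simp add: c_def)
    next
      case False
      then show ?thesis using ij unfolding c_def by auto presburger+
    qed
  qed
  then have "\<exists>h L. length L = length h \<and> k \<le> card (colors_at c [] h L) \<and>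
    (\<forall>b T. forcing (arrival_graph G \<pi>) s k b T \<longrightarrow> (\<exists>vs. length vs = length h \<and> distinct vs \<and> set vs \<subseteq> T
      \<and> hist (arrival_graph G \<pi>) vs = h \<and> (\<forall>i<length vs. (s (vs ! i) = b) = L ! i)))"
    by (rule force_colors) (auto intro: arrival_graph_sym dest: bip)
  then obtain h L where hL: "length L = length h" "k \<le> card (colors_at c [] h L)"
    and real: "\<forall>b T. forcing (arrival_graph G \<pi>) s k b T \<longrightarrow> (\<exists>vs. length vs = length h \<and> distinct vs \<and> set vs \<subseteq> T
      \<and> hist (arrival_graph G \<pi>) vs = h \<and> (\<forall>i<length vs. (s (vs ! i) = b) = L ! i))"
    by (elim exE conjE) (rule that)
  obtain us where us: "length us = length h" "distinct us" "set us \<subseteq> T" "hist (arrival_graph G \<pi>) us = h"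
    using real forcing by metis
  define ws where "ws = map ((!) \<pi>) us"
  have d\<pi>: "distinct \<pi>" "set \<pi> = verts G" using \<pi> by (auto simp: permutations_of_set_def)
  have us': "set us \<subseteq> {..<length \<pi>}" using us(3) T by blast
  then have us'': "i < length \<pi>" if "i \<in> set us" for i using that by blast
  then have "inj_on ((!) \<pi>) (set us)" using d\<pi>(1) by (auto simp: inj_on_def nth_eq_iff_index_eq)
  then have ws: "distinct ws" "set ws \<subseteq> verts G"
    using d\<pi>(2) us(2) us'' by (auto simp: ws_def distinct_map)
  have "hist ?adj ws = hist (arrival_graph G \<pi>) us"
    unfolding ws_def hist_map by (intro hist_cong) (simp add: arrival_graph_def us'')
  then have hws: "hist ?adj ws = h" using us by simp
  obtain vs where vs: "ws @ vs \<in> permutations_of_set (verts G)"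
    using permutation_extending[OF fin ws] .
  let ?f = "online_coloring A G (ws @ vs) (\<lambda>_. ())"
  have len: "length ws = length h" by (simp add: hws[symmetric])
  \<comment> \<open>The presented history embeds into \<open>G\<close>, so every color of the game
    is twice a color that \<open>A\<close> uses on the order \<open>ws @ vs\<close>.\<close>
  have "colors_at c [] h L \<subseteq> (\<lambda>x. 2 * x) ` ?f ` verts G"
  proof
    fix y assume "y \<in> colors_at c [] h L"
    then obtain i where i: "i < length h" "y = c (take (Suc i) h)"
      by (auto simp: colors_at_def)
    have "emb (take (Suc i) h)" unfolding emb_def hws[symmetric] hist_take[symmetric] using ws
      by (intro exI[of _ "take (Suc i) ws"]) (auto dest: in_set_takeD)
    then have "y = 2 * ?f (ws ! i)" using i len hws by (simp add: c_def A'[OF vs])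
    moreover have "ws ! i \<in> verts G" using i len ws(2) by auto
    ultimately show "y \<in> (\<lambda>x. 2 * x) ` ?f ` verts G" by blast
  qed
  then have "card (colors_at c [] h L) \<le> card ((\<lambda>x. 2 * x) ` ?f ` verts G)"
    using fin by (intro card_mono) auto
  also have "\<dots> \<le> num_colors G ?f" unfolding num_colors_def using fin by (intro card_image_le) auto
  also have "\<dots> \<le> algorithm_chromatic_number A G"
    unfolding algorithm_chromatic_number_def using vs fin by (intro Max_ge) auto
  finally show ?thesis using hL(2) AG by simp
qed

section \<open>Induced paths and merge trees\<close>

definition conn :: "('a \<Rightarrow> 'a \<Rightarrow> bool) \<Rightarrow> 'a set \<Rightarrow> bool" where
  "conn E X \<longleftrightarrow> (\<forall>u\<in>X. \<forall>v\<in>X. (u, v) \<in> {(a, b). a \<in> X \<and> b \<in> X \<and> E a b}\<^sup>*)"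

text \<open>Recursive form of an induced path, testing adjacency in one direction only. For
  symmetric and bipartite \<open>E\<close>, \<open>ipath_nth\<close> gives the usual index
  form.\<close>

fun ipath :: "('a \<Rightarrow> 'a \<Rightarrow> bool) \<Rightarrow> 'a list \<Rightarrow> bool" where
  "ipath E [] \<longleftrightarrow> True"
| "ipath E [u] \<longleftrightarrow> True"
| "ipath E (u # v # vs) \<longleftrightarrow> E u v \<and> u \<notin> set (v # vs) \<and> (\<forall>w\<in>set vs. \<not> E u w) \<and> ipath E (v # vs)"

lemma ipath_append:
  assumes "ipath E p" "ipath E q" "p \<noteq> []" "q \<noteq> []" "last p = hd q"
    "\<And>a b. a \<in> set (butlast p) \<Longrightarrow> b \<in> set (tl q) \<Longrightarrow> a \<noteq> b \<and> \<not> E a b"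
  shows "ipath E (p @ tl q)"
  using assms
proof (induction p rule: induct_list012)
  case (2 u)
  then show ?case by (cases q) auto
next
  case (3 u v vs)
  have "a \<noteq> b \<and> \<not> E a b" if "a \<in> set (butlast (v # vs))" "b \<in> set (tl q)" for a b
    using that 3(8)[of a b] by simp
  then have "ipath E ((v # vs) @ tl q)" using 3(3-7) by (intro 3(2)) auto
  moreover have "u \<noteq> b \<and> \<not> E u b" if "b \<in> set (tl q)" for b using 3(8)[of u b] that by simp
  ultimately show ?case using 3(3) by auto
qed simp

lemma ipath_take: "ipath E p \<Longrightarrow> ipath E (take n p)"
proof (induction p arbitrary: n rule: induct_list012)
  case (3 u v vs)
  show ?case
  proof (cases n)
    case (Suc m)
    show ?thesis
    proof (cases m)
      case (Suc l)
      have "ipath E (take m (v # vs))" using 3(2,3) by simp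
      then show ?thesis using 3(3) \<open>n = Suc m\<close> Suc by (auto dest: in_set_takeD)
    qed (use \<open>n = Suc m\<close> in simp)
  qed simp
qed (auto simp: take_Cons')

lemma ipath_distinct: "ipath E p \<Longrightarrow> distinct p"
  by (induction p rule: induct_list012) auto

lemma ipath_Suc: "ipath E p \<Longrightarrow> Suc i < length p \<Longrightarrow> E (p ! i) (p ! Suc i)"
proof (induction p arbitrary: i rule: induct_list012)
  case (3 u v vs)
  then show ?case by (cases i) auto
qed auto

text \<open>Models an arriving vertex \<open>x\<close> together with two components that its arrival
  merges.\<close>

definition fork :: "('a \<Rightarrow> 'a \<Rightarrow> bool) \<Rightarrow> 'a \<Rightarrow> 'a set \<Rightarrow> 'a set \<Rightarrow> bool" where
  "fork E x D1 D2 \<longleftrightarrow> x \<notin> D1 \<and> x \<notin> D2 \<and> conn E D1 \<and> conn E D2 \<and> anticomplete E D1 D2 \<and>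
     (\<exists>d\<in>D1. E x d) \<and> (\<exists>d\<in>D2. E x d)"

lemma fork_sym: "fork E x D1 D2 \<Longrightarrow> fork E x D2 D1"
  unfolding fork_def using anticomplete_sym by blast

text \<open>As \<open>forcing\<close> is downward closed in \<open>k\<close>, this compares the
  largest numbers of colors forced on the two sides without naming them.\<close>

definition strong :: "('a \<Rightarrow> 'a \<Rightarrow> bool) \<Rightarrow> ('a \<Rightarrow> bool) \<Rightarrow> bool \<Rightarrow> 'a set \<Rightarrow> bool" where
  "strong E s b T \<longleftrightarrow> (\<forall>k. forcing E s k (\<not> b) T \<longrightarrow> forcing E s k b T)"

text \<open>The merge tree behind a vertex of index \<open>n\<close> that votes for side \<open>b\<close>: the vertex \<open>x\<close> merges two components
  in which the previous index votes for opposite sides.\<close>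

primrec node :: "('a \<Rightarrow> 'a \<Rightarrow> bool) \<Rightarrow> ('a \<Rightarrow> bool) \<Rightarrow> nat \<Rightarrow> bool \<Rightarrow> 'a set \<Rightarrow> bool" where
  "node E s 0 b T \<longleftrightarrow> T \<noteq> {} \<and> strong E s b T"
| "node E s (Suc n) b T \<longleftrightarrow> strong E s b T \<and>
     (\<exists>x D1 D2 T1 T2. x \<in> T \<and> D1 \<subseteq> T \<and> D2 \<subseteq> T \<and> fork E x D1 D2 \<and> (strong E s (\<not> b) T \<longrightarrow> s x = b) \<and>
        T1 \<subseteq> D1 \<and> node E s n b T1 \<and> T2 \<subseteq> D2 \<and> node E s n (\<not> b) T2)"

lemma node_SucE:
  assumes "node E s (Suc n) b T"
  obtains x D1 D2 T1 T2 where "x \<in> T" "D1 \<subseteq> T" "D2 \<subseteq> T" "fork E x D1 D2" "strong E s (\<not> b) T \<longrightarrow> s x = b"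
    "T1 \<subseteq> D1" "node E s n b T1" "T2 \<subseteq> D2" "node E s n (\<not> b) T2"
  using assms unfolding node.simps by (elim conjE exE) (rule that)

lemma node_strong: "node E s n b T \<Longrightarrow> strong E s b T"
  by (cases n) auto

lemma node_le: "node E s n b T \<Longrightarrow> m \<le> n \<Longrightarrow> \<exists>T'\<subseteq>T. node E s m b T'"
proof (induction n arbitrary: T)
  case (Suc n)
  show ?case
  proof (cases "m = Suc n")
    case False
    then have "m \<le> n" using Suc.prems by simp
    from Suc.prems(1) obtain D1 T1 where "D1 \<subseteq> T" "T1 \<subseteq> D1" "node E s n b T1" by (rule node_SucE)
    with Suc.IH[of T1] \<open>m \<le> n\<close> show ?thesis by (meson subset_trans)
  qed (use Suc.prems in blast)
qed auto

lemma node_card: "node E s n b T \<Longrightarrow> finite T \<Longrightarrow> 2 ^ n \<le> card T"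
proof (induction n arbitrary: b T)
  case 0
  then show ?case by (simp add: Suc_le_eq card_gt_0_iff)
next
  case (Suc n)
  from Suc.prems(1) obtain x D1 D2 T1 T2 where *: "D1 \<subseteq> T" "D2 \<subseteq> T" "fork E x D1 D2"
    "T1 \<subseteq> D1" "node E s n b T1" "T2 \<subseteq> D2" "node E s n (\<not> b) T2" by (rule node_SucE)
  then have "T1 \<subseteq> T" "T2 \<subseteq> T" "T1 \<inter> T2 = {}" by (auto simp: fork_def anticomplete_def)
  moreover from this Suc.prems(2) have "finite T1" "finite T2" by (auto intro: finite_subset)
  ultimately have "finite T1" "finite T2" "card T1 + card T2 \<le> card T"
    using Suc.prems(2) card_Un_disjoint[of T1 T2] card_mono[of T "T1 \<union> T2"] by auto
  with Suc.IH[OF *(5)] Suc.IH[OF *(7)] show ?case by simp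
qed

lemma node_forcing:
  assumes "node E s n b T" "forcing E s j c T"
  shows "forcing E s j b T"
proof (cases "c = b")
  case False
  then have "c = (\<not> b)" by simp
  then show ?thesis using node_strong[OF assms(1)] assms(2) unfolding strong_def by blast
qed (use assms(2) in simp)

text \<open>The measure of progress along the merge tree. The side \<open>c\<close> is left open,
  but by \<open>node_forcing\<close> the side voted for always qualifies.\<close>

definition level_forces :: "('a \<Rightarrow> 'a \<Rightarrow> bool) \<Rightarrow> ('a \<Rightarrow> bool) \<Rightarrow> nat \<Rightarrow> nat \<Rightarrow> bool" where
  "level_forces E s n j \<longleftrightarrow> (\<forall>b T. node E s n b T \<longrightarrow> (\<exists>c. forcing E s j c T))"

text \<open>One level higher there are two children voting for opposite sides, and each forces
  \<open>j\<close> colors on the side of its vote.\<close>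

lemma level_forces_both:
  assumes "level_forces E s n j" "node E s m b T" "n < m"
  shows "forcing E s j c T"
proof -
  obtain T' where T': "T' \<subseteq> T" "node E s (Suc n) b T'" using node_le[OF assms(2), of "Suc n"] assms(3) Suc_leI by blast
  from T'(2) obtain x D1 D2 T1 T2 where *: "D1 \<subseteq> T'" "D2 \<subseteq> T'"
    "T1 \<subseteq> D1" "node E s n b T1" "T2 \<subseteq> D2" "node E s n (\<not> b) T2" by (rule node_SucE)
  have "forcing E s j b T1" "forcing E s j (\<not> b) T2"
    using *(4,6) assms(1) node_forcing unfolding level_forces_def by metis+
  then have "forcing E s j b T" "forcing E s j (\<not> b) T" using *(1-3,5) T'(1) forcing_mono by (metis subset_trans)+
  then show ?thesis by (cases "c = b") auto
qed

section \<open>Induced paths in bipartite graphs\<close>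

locale bipartition =
  fixes E :: "'a \<Rightarrow> 'a \<Rightarrow> bool" and s :: "'a \<Rightarrow> bool"
  assumes sym: "E u v \<Longrightarrow> E v u" and bip: "E u v \<Longrightarrow> s u \<noteq> s v"
begin

lemma ipath_rev: "ipath E p \<Longrightarrow> ipath E (rev p)"
proof (induction p rule: induct_list012)
  case (3 u v vs)
  have "ipath E (rev (v # vs) @ tl [v, u])"
  proof (rule ipath_append)
    show "ipath E (rev (v # vs))" "ipath E [v, u]" using 3(2,3) sym by auto
    show "a \<noteq> b \<and> \<not> E a b" if "a \<in> set (butlast (rev (v # vs)))" "b \<in> set (tl [v, u])" for a b
      using that 3(3) sym by auto
  qed auto
  then show ?case by simp
qed auto

lemma ipath_nth:
  "ipath E p \<Longrightarrow> i < length p \<Longrightarrow> j < length p \<Longrightarrow> E (p ! i) (p ! j) \<longleftrightarrow> i = Suc j \<or> j = Suc i"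
proof (induction p arbitrary: i j rule: induct_list012)
  case (2 u)
  then show ?case using bip[of u u] by auto
next
  case (3 u v vs)
  have u: "E u ((v # vs) ! k) \<longleftrightarrow> k = 0" if "k < length (v # vs)" for k
    using that 3(3) by (cases k) auto
  have u': "E ((v # vs) ! k) u \<longleftrightarrow> k = 0" if "k < length (v # vs)" for k
    using u[OF that] sym by blast
  show ?case
  proof (cases i)
    case 0
    then show ?thesis using 3(5) u bip[of u u] by (cases j) auto
  next
    case (Suc i')
    then show ?thesis using 3(2)[of i'] 3(3-5) u' by (cases j) auto
  qed
qed auto

lemma ipath_parity: "ipath E p \<Longrightarrow> i < length p \<Longrightarrow> (s (p ! i) = s (p ! 0)) = even i"
proof (induction i)
  case (Suc i)
  then have "s (p ! i) \<noteq> s (p ! Suc i)" using ipath_Suc bip by metis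
  with Suc show ?case by auto
qed simp

text \<open>A walk is followed step by step. If the next vertex already lies on the induced path
  built so far, the path is cut there; otherwise it is cut at the first neighbor of that vertex,
  which keeps it induced.\<close>

lemma ipath_exists:
  assumes "(v, w) \<in> {(a, b). a \<in> Y \<and> b \<in> Y \<and> E a b}\<^sup>*" "v \<in> Y"
  shows "\<exists>p. ipath E p \<and> p \<noteq> [] \<and> hd p = v \<and> last p = w \<and> set p \<subseteq> Y"
  using assms(1)
proof (induction rule: rtrancl_induct)
  case base
  show ?case using assms(2) by (intro exI[of _ "[v]"]) auto
next
  case (step u w)
  then obtain p where p: "ipath E p" "p \<noteq> []" "hd p = v" "last p = u" "set p \<subseteq> Y" by blast
  show ?case
  proof (cases "w \<in> set p")
    case True
    then obtain i where i: "i < length p" "p ! i = w" by (auto simp: in_set_conv_nth)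
    then have "last (take (Suc i) p) = w" by (simp add: take_Suc_conv_app_nth)
    then show ?thesis using p ipath_take by (intro exI[of _ "take (Suc i) p"]) (auto dest: in_set_takeD)
  next
    case False
    define i where "i = (LEAST i. i < length p \<and> E (p ! i) w)"
    have "E (p ! (length p - 1)) w" using p step(2) by (simp add: last_conv_nth)
    then have "\<exists>i. i < length p \<and> E (p ! i) w" using p(2) by (intro exI[of _ "length p - 1"]) auto
    then have i: "i < length p" "E (p ! i) w" unfolding i_def by (metis (mono_tags, lifting) LeastI)+
    have least: "\<not> E (p ! k) w" if "k < i" for k
      using not_less_Least[OF that[unfolded i_def]] that i(1) by (meson less_trans i_def)
    let ?q = "take (Suc i) p"
    have q: "?q \<noteq> []" "last ?q = p ! i" "butlast ?q = take i p" using i(1) p(2)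
      by (auto simp: take_Suc_conv_app_nth)
    have "ipath E (?q @ tl [p ! i, w])"
    proof (rule ipath_append)
      show "ipath E ?q" using p(1) by (rule ipath_take)
      show "ipath E [p ! i, w]" using i False by auto
      show "a \<noteq> b \<and> \<not> E a b" if ab: "a \<in> set (butlast ?q)" "b \<in> set (tl [p ! i, w])" for a b
      proof -
        obtain k where "k < i" "a = p ! k" using ab(1) i(1) unfolding q(3) by (auto simp: in_set_conv_nth)
        then show ?thesis using ab(2) least[of k] False nth_mem[of k p] i(1) by auto
      qed
    qed (use q in auto)
    then show ?thesis using p step(2) q
      by (intro exI[of _ "?q @ [w]"]) (auto dest: in_set_takeD simp: hd_append)
  qed
qed

text \<open>The parity clause is the point: knowing the sides of \<open>v\<close> and
  \<open>w\<close> excludes every second length.\<close>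

lemma ipath_into:
  assumes "conn E X" "v \<notin> X" "d \<in> X" "E v d" "w \<in> X"
  obtains p where "ipath E p" "2 \<le> length p" "hd p = v" "last p = w" "set (tl p) \<subseteq> X"
    "even (length p) = (s v \<noteq> s w)"
proof -
  let ?R = "\<lambda>X. {(a, b). a \<in> X \<and> b \<in> X \<and> E a b}"
  have "(d, w) \<in> (?R X)\<^sup>*" using assms unfolding conn_def by blast
  moreover have "(?R X)\<^sup>* \<subseteq> (?R (insert v X))\<^sup>*" by (intro rtrancl_mono) auto
  ultimately have "(v, w) \<in> (?R (insert v X))\<^sup>*"
    using assms(3,4) by (intro converse_rtrancl_into_rtrancl[of v d]) auto
  from ipath_exists[OF this] obtain p where p: "ipath E p" "p \<noteq> []" "hd p = v" "last p = w" "set p \<subseteq> insert v X"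
    by auto
  have "length p \<noteq> 1"
  proof
    assume "length p = 1"
    then obtain y where "p = [y]" by (auto simp: length_Suc_conv)
    then show False using p assms(2,5) by auto
  qed
  then have len: "2 \<le> length p" using p(2) by (cases p) (auto simp: Suc_le_eq)
  have "v \<notin> set (tl p)" using ipath_distinct[OF p(1)] p(2,3) by (cases p) auto
  then have "set (tl p) \<subseteq> X" using p(5) by (auto dest: list.set_sel(2)[OF p(2)])
  moreover have "(s w = s v) = even (length p - 1)"
    using ipath_parity[OF p(1), of "length p - 1"] p(2-4) by (simp add: last_conv_nth hd_conv_nth)
  then have "even (length p) = (s v \<noteq> s w)" using len by (cases "length p") auto
  ultimately show ?thesis using that p len by blast
qed

lemma conn_insert:
  assumes "conn E X" "d \<in> X" "E z d"
  shows "conn E (insert z X)"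
proof -
  let ?R = "\<lambda>X. {(a, b). a \<in> X \<and> b \<in> X \<and> E a b}"
  have mono: "(?R X)\<^sup>* \<subseteq> (?R (insert z X))\<^sup>*" by (intro rtrancl_mono) auto
  have "(u, d) \<in> (?R (insert z X))\<^sup>* \<and> (d, u) \<in> (?R (insert z X))\<^sup>*" if "u \<in> insert z X" for u
  proof (cases "u \<in> X")
    case True
    then show ?thesis using assms(1,2) mono unfolding conn_def by blast
  next
    case False
    then show ?thesis using that assms(2,3) sym[OF assms(3)] by (auto intro: r_into_rtrancl)
  qed
  then show ?thesis unfolding conn_def by (meson rtrancl_trans)
qed

definition leg :: "'a \<Rightarrow> 'a set \<Rightarrow> nat \<Rightarrow> bool" where
  "leg v X n \<longleftrightarrow> (\<exists>p. ipath E p \<and> hd p = v \<and> set (tl p) \<subseteq> X \<and> length p = n)"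

lemma legI:
  assumes "ipath E p" "hd p = v" "set (tl p) \<subseteq> X" "n \<le> length p" "0 < n"
  shows "leg v X n"
  unfolding leg_def
proof (intro exI conjI)
  show "ipath E (take n p)" using assms ipath_take by blast
  show "hd (take n p) = v" "length (take n p) = n" using assms by auto
  have "tl (take n p) = take (n - 1) (tl p)" using assms(5) by (cases p; cases n) auto
  then show "set (tl (take n p)) \<subseteq> X" using assms(3) by (auto dest: in_set_takeD)
qed

text \<open>A leg counts its starting vertex, which the two legs share; this is the reason for the
  \<open>- 1\<close>.\<close>

lemma legs_join:
  assumes "leg v X m" "leg v Y n" "anticomplete E X Y" "0 < m" "0 < n"
  shows "\<exists>p. ipath E p \<and> length p = m + n - 1"
proof -
  from assms obtain p q where p: "ipath E p" "hd p = v" "set (tl p) \<subseteq> X" "length p = m"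
    and q: "ipath E q" "hd q = v" "set (tl q) \<subseteq> Y" "length q = n" unfolding leg_def by blast
  have ne: "p \<noteq> []" "q \<noteq> []" using p q assms by auto
  have "ipath E (rev p @ tl q)"
  proof (rule ipath_append)
    show "ipath E (rev p)" using p(1) by (rule ipath_rev)
    show "last (rev p) = hd q" using p q ne by (simp add: last_rev)
    have "set (butlast (rev p)) \<subseteq> X" using p(3) ne by (cases p) auto
    then show "a \<noteq> b \<and> \<not> E a b" if "a \<in> set (butlast (rev p))" "b \<in> set (tl q)" for a b
      using that q(3) assms(3) unfolding anticomplete_def by blast
  qed (use q ne in auto)
  then show ?thesis using p q assms(4,5) by (intro exI[of _ "rev p @ tl q"]) auto
qed

text \<open>An induced path from \<open>v\<close> to \<open>w\<close> has an even number of vertices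
  since the sides differ, and not two since \<open>v\<close> and \<open>w\<close> are not
  adjacent.\<close>

lemma leg_4:
  assumes "conn E X" "v \<notin> X" "d \<in> X" "E v d" "w \<in> X" "s w \<noteq> s v" "\<not> E v w"
  shows "leg v X 4"
proof -
  obtain p where p: "ipath E p" "2 \<le> length p" "hd p = v" "last p = w" "set (tl p) \<subseteq> X"
    "even (length p) = (s v \<noteq> s w)" using ipath_into[OF assms(1-5)] .
  have "length p \<noteq> 2"
  proof
    assume 2: "length p = 2"
    then have "E (p ! 0) (p ! 1)" using ipath_Suc[OF p(1), of 0] by simp
    then show False using p 2 assms(7) by (simp add: last_conv_nth hd_conv_nth flip: length_0_conv)
  qed
  moreover have "length p \<noteq> 3" using p(6) assms(6) by auto
  ultimately have "4 \<le> length p" using p(2) by linarith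
  then show ?thesis using p by (intro legI[of p]) auto
qed

lemma leg_3:
  assumes "conn E X" "v \<notin> X" "d \<in> X" "E v d" "w \<in> X" "s w = s v"
  shows "leg v X 3"
proof -
  obtain p where p: "ipath E p" "2 \<le> length p" "hd p = v" "last p = w" "set (tl p) \<subseteq> X"
    "even (length p) = (s v \<noteq> s w)" using ipath_into[OF assms(1-5)] .
  have "length p \<noteq> 2" using p(6) assms(6) by auto
  then show ?thesis using p by (intro legI[of p]) auto
qed

lemma forcing_nonempty_side: "forcing E s j b T \<Longrightarrow> 0 < j \<Longrightarrow> \<exists>v\<in>T. s v = b"
  by (rule forcing_oneD, rule forcing_antimono, assumption) (rule Suc_leI)

text \<open>Two anticomplete sets that force \<open>j\<close> colors on both sides serve both
  answers of the algorithm at once, provided that \<open>x\<close> is complete to their vertices of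
  the opposite side.\<close>

lemma forcing_gain:
  assumes "x \<in> T" "R1 \<subseteq> T" "R2 \<subseteq> T" "anticomplete E R1 R2" "x \<notin> R1" "x \<notin> R2"
    "\<And>b. forcing E s j b R1" "\<And>b. forcing E s j b R2"
    "\<And>u. u \<in> R1 \<union> R2 \<Longrightarrow> s u \<noteq> s x \<Longrightarrow> E x u"
  shows "forcing E s (Suc j) (s x) T"
  unfolding forcing.simps
proof (intro conjI)
  show "\<exists>T1 T2. T1 \<subseteq> T \<and> T2 \<subseteq> T \<and> anticomplete E T1 T2 \<and> forcing E s j (s x) T1 \<and> forcing E s j (s x) T2"
    by (rule exI[of _ R1], rule exI[of _ R2]) (intro conjI assms(2-4,7,8))
  show "\<exists>y T1 T2. y \<in> T \<and> s y = s x \<and> T1 \<subseteq> T \<and> T2 \<subseteq> T \<and> y \<notin> T1 \<and> y \<notin> T2 \<and>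
      anticomplete E T1 T2 \<and> forcing E s j (s x) T1 \<and> forcing E s j (\<not> s x) T2 \<and>
      (\<forall>u\<in>T1 \<union> T2. s u \<noteq> s x \<longrightarrow> E y u)"
    by (rule exI[of _ x], rule exI[of _ R1], rule exI[of _ R2]) (intro conjI ballI impI assms refl)
qed

section \<open>Forced colors along the merge tree\<close>

lemma level_0: "level_forces E s 0 (Suc 0)"
  unfolding level_forces_def
proof (intro allI impI)
  fix b T assume "node E s 0 b T"
  then obtain v where "v \<in> T" by auto
  then show "\<exists>c. forcing E s (Suc 0) c T" using forcing_one[of v T s "s v"] by blast
qed

text \<open>Holds without any forbidden path: it suffices to find a neighbor \<open>d\<close> of the
  merging vertex \<open>x\<close> and a vertex \<open>a\<close> on the side of \<open>x\<close> that
  is not adjacent to \<open>d\<close>. Equal answers are met by presenting \<open>x\<close> after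
  \<open>a\<close> and \<open>d\<close>, different ones by the pair \<open>x\<close>,
  \<open>a\<close>.\<close>

lemma level_1: "level_forces E s (Suc 0) (Suc (Suc 0))"
  unfolding level_forces_def
proof (intro allI impI)
  fix b T assume "node E s (Suc 0) b T"
  then obtain x D1 D2 T1 T2 where n: "x \<in> T" "D1 \<subseteq> T" "D2 \<subseteq> T" "fork E x D1 D2"
    "T1 \<subseteq> D1" "node E s 0 b T1" "T2 \<subseteq> D2" "node E s 0 (\<not> b) T2" by (rule node_SucE)
  have "forcing E s (Suc 0) b T1" "forcing E s (Suc 0) (\<not> b) T2"
    using level_0 n(6,8) node_forcing unfolding level_forces_def by metis+
  then obtain t1 t2 where t: "t1 \<in> D1" "s t1 = b" "t2 \<in> D2" "s t2 = (\<not> b)"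
    using n(5,7) forcing_oneD[of E s b T1] forcing_oneD[of E s "\<not> b" T2] by blast
  from n(4) obtain d1 d2 where d: "d1 \<in> D1" "E x d1" "d2 \<in> D2" "E x d2" unfolding fork_def by blast
  have anti: "anticomplete E D1 D2" "x \<notin> D1" "x \<notin> D2" using n(4) unfolding fork_def by auto
  \<comment> \<open>The children contain vertices of opposite sides. The one on the side of
    \<open>x\<close> becomes \<open>a\<close>, and \<open>d\<close> is a neighbor of
    \<open>x\<close> in the other component.\<close>
  have "\<exists>a d. a \<in> T \<and> d \<in> T \<and> a \<noteq> d \<and> a \<noteq> x \<and> d \<noteq> x \<and> \<not> E a d \<and> s a = s x \<and> E x d"
  proof (cases "s x = b")
    case True
    then have "t1 \<noteq> d2" "\<not> E t1 d2" "s t1 = s x" using t d anti unfolding anticomplete_def by auto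
    moreover have "t1 \<in> T" "d2 \<in> T" "t1 \<noteq> x" "d2 \<noteq> x" using t(1) d(3) anti(2,3) n(2,3) by auto
    ultimately show ?thesis using d(4) by blast
  next
    case False
    then have "t2 \<noteq> d1" "\<not> E t2 d1" "s t2 = s x" using t d anti unfolding anticomplete_def by auto
    moreover have "t2 \<in> T" "d1 \<in> T" "t2 \<noteq> x" "d1 \<noteq> x" using t(3) d(1) anti(2,3) n(2,3) by auto
    ultimately show ?thesis using d(2) by blast
  qed
  then obtain a d where a: "a \<in> T" "d \<in> T" "a \<noteq> d" "a \<noteq> x" "d \<noteq> x" "\<not> E a d" "s a = s x" "E x d" by blast
  have f: "forcing E s (Suc 0) (s v) {v}" for v using forcing_one[of v "{v}" s] by simp
  have "forcing E s (Suc (Suc 0)) (s x) T"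
    unfolding forcing.simps(2)[of E s "Suc 0"]
  proof (intro conjI)
    have "anticomplete E {x} {a}" using a bip unfolding anticomplete_def by auto
    then show "\<exists>T1 T2. T1 \<subseteq> T \<and> T2 \<subseteq> T \<and> anticomplete E T1 T2 \<and> forcing E s (Suc 0) (s x) T1 \<and>
        forcing E s (Suc 0) (s x) T2"
      using f[of x] f[of a] a n(1) by (intro exI[of _ "{x}"] exI[of _ "{a}"]) simp
    have "anticomplete E {a} {d}" using a sym unfolding anticomplete_def by auto
    moreover have "s d = (\<not> s x)" using bip[OF a(8)] by simp
    ultimately show "\<exists>xa T1 T2. xa \<in> T \<and> s xa = s x \<and> T1 \<subseteq> T \<and> T2 \<subseteq> T \<and> xa \<notin> T1 \<and> xa \<notin> T2 \<and>
        anticomplete E T1 T2 \<and> forcing E s (Suc 0) (s x) T1 \<and> forcing E s (Suc 0) (\<not> s x) T2 \<and>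
        (\<forall>u\<in>T1 \<union> T2. s u \<noteq> s x \<longrightarrow> E xa u)"
      using f[of d] f[of a] a n(1) by (intro exI[of _ x] exI[of _ "{a}"] exI[of _ "{d}"]) auto
  qed
  then show "\<exists>c. forcing E s (Suc (Suc 0)) c T" by blast
qed

text \<open>A nonneighbor \<open>u\<close> would give a leg of four vertices into \<open>D1\<close>,
  and \<open>w\<close> gives one of three into \<open>D2\<close>.\<close>

lemma P6_free_complete:
  assumes "\<nexists>p. ipath E p \<and> length p = 6" "fork E x D1 D2" "w \<in> D2" "s w = s x" "u \<in> D1" "s u \<noteq> s x"
  shows "E x u"
proof (rule ccontr)
  assume "\<not> E x u"
  then have "leg x D1 4" "leg x D2 3"
    using assms(2-6) leg_4[of D1 x _ u] leg_3[of D2 x _ w] unfolding fork_def by blast+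
  then show False using legs_join[of x D1 4 D2 3] assms(1,2) unfolding fork_def by simp
qed

text \<open>Nonneighbors on the opposite side in both components would give two legs of four
  vertices. Unlike in the case of six vertices, completeness is obtained for one component
  only.\<close>

lemma P7_free_complete:
  assumes "\<nexists>p. ipath E p \<and> length p = 7" "fork E x D1 D2"
  shows "(\<forall>u\<in>D1. s u \<noteq> s x \<longrightarrow> E x u) \<or> (\<forall>u\<in>D2. s u \<noteq> s x \<longrightarrow> E x u)"
proof (rule ccontr)
  assume "\<not> ?thesis"
  then obtain u1 u2 where "u1 \<in> D1" "s u1 \<noteq> s x" "\<not> E x u1" "u2 \<in> D2" "s u2 \<noteq> s x" "\<not> E x u2" by blast
  then have "leg x D1 4" "leg x D2 4"
    using assms(2) leg_4[of D1 x _ u1] leg_4[of D2 x _ u2] unfolding fork_def by blast+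
  then show False using legs_join[of x D1 4 D2 4] assms unfolding fork_def by simp
qed

text \<open>Since \<open>x\<close> is complete to both components, the two children themselves serve
  as the sets for \<open>forcing_gain\<close>. One level makes them force on both sides and one
  merges them.\<close>

lemma P6_free_level_step:
  assumes "\<nexists>p. ipath E p \<and> length p = 6" "level_forces E s n j" "0 < j"
  shows "level_forces E s (n + 2) (Suc j)"
  unfolding level_forces_def
proof (intro allI impI)
  fix b T assume "node E s (n + 2) b T"
  then have "node E s (Suc (Suc n)) b T" by simp
  then obtain x D1 D2 T1 T2 where n: "x \<in> T" "D1 \<subseteq> T" "D2 \<subseteq> T" "fork E x D1 D2"
    "T1 \<subseteq> D1" "node E s (Suc n) b T1" "T2 \<subseteq> D2" "node E s (Suc n) (\<not> b) T2" by (rule node_SucE)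
  have f: "forcing E s j c T1" "forcing E s j c T2" for c
    using level_forces_both[OF assms(2)] n(6,8) by blast+
  obtain w1 w2 where "w1 \<in> T1" "s w1 = s x" "w2 \<in> T2" "s w2 = s x"
    using forcing_nonempty_side[OF f(1) assms(3)] forcing_nonempty_side[OF f(2) assms(3)] by blast
  then have "E x u" if "u \<in> T1 \<union> T2" "s u \<noteq> s x" for u
    using that n(5,7) P6_free_complete[OF assms(1) n(4), of w2 u]
      P6_free_complete[OF assms(1) fork_sym[OF n(4)], of w1 u] by blast
  then have "forcing E s (Suc j) (s x) T"
    using n f unfolding fork_def by (intro forcing_gain[of x T T1 T2]) (auto intro: anticomplete_mono)
  then show "\<exists>c. forcing E s (Suc j) c T" by blast
qed

text \<open>When \<open>x\<close> is complete to one component only, both anticomplete sets must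
  come from inside it, which costs one further level.\<close>

lemma forcing_gain_node:
  assumes "level_forces E s n j" "node E s m b U" "Suc n < m" "U \<subseteq> T" "x \<in> T" "x \<notin> U"
    "\<And>u. u \<in> U \<Longrightarrow> s u \<noteq> s x \<Longrightarrow> E x u"
  shows "forcing E s (Suc j) (s x) T"
proof -
  obtain m' where m': "m = Suc m'" "n < m'" using assms(3) by (cases m) auto
  from assms(2)[unfolded m'(1)] obtain y D1 D2 T1 T2 where n: "y \<in> U" "D1 \<subseteq> U" "D2 \<subseteq> U" "fork E y D1 D2"
    "T1 \<subseteq> D1" "node E s m' b T1" "T2 \<subseteq> D2" "node E s m' (\<not> b) T2" by (rule node_SucE)
  have f: "forcing E s j c T1" "forcing E s j c T2" for c
    using level_forces_both[OF assms(1)] n(6,8) m'(2) by blast+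
  have "anticomplete E T1 T2" using n unfolding fork_def by (auto intro: anticomplete_mono)
  then show ?thesis using n f assms(4-7) by (intro forcing_gain[of x T T1 T2]) auto
qed

lemma P7_free_level_step:
  assumes "\<nexists>p. ipath E p \<and> length p = 7" "level_forces E s n j"
  shows "level_forces E s (n + 3) (Suc j)"
  unfolding level_forces_def
proof (intro allI impI)
  fix b T assume "node E s (n + 3) b T"
  then have "node E s (Suc (n + 2)) b T" by (simp add: numeral_3_eq_3)
  then obtain x D1 D2 T1 T2 where n: "x \<in> T" "D1 \<subseteq> T" "D2 \<subseteq> T" "fork E x D1 D2"
    "T1 \<subseteq> D1" "node E s (n + 2) b T1" "T2 \<subseteq> D2" "node E s (n + 2) (\<not> b) T2" by (rule node_SucE)
  have x: "x \<notin> D1" "x \<notin> D2" using n(4) unfolding fork_def by auto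
  have "forcing E s (Suc j) (s x) T"
    using P7_free_complete[OF assms(1) n(4)]
  proof
    assume "\<forall>u\<in>D1. s u \<noteq> s x \<longrightarrow> E x u"
    then have "\<And>u. u \<in> T1 \<Longrightarrow> s u \<noteq> s x \<Longrightarrow> E x u" using n(5) by blast
    moreover have "T1 \<subseteq> T" "x \<notin> T1" using n(2,5) x by auto
    ultimately show ?thesis using forcing_gain_node[OF assms(2) n(6) _ _ n(1)] by simp
  next
    assume "\<forall>u\<in>D2. s u \<noteq> s x \<longrightarrow> E x u"
    then have "\<And>u. u \<in> T2 \<Longrightarrow> s u \<noteq> s x \<Longrightarrow> E x u" using n(7) by blast
    moreover have "T2 \<subseteq> T" "x \<notin> T2" using n(3,7) x by auto
    ultimately show ?thesis using forcing_gain_node[OF assms(2) n(8) _ _ n(1)] by simp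
  qed
  then show "\<exists>c. forcing E s (Suc j) c T" by blast
qed

section \<open>Rich sets and joints, for graphs without induced path on nine vertices\<close>

definition rich :: "nat \<Rightarrow> 'a set \<Rightarrow> bool" where
  "rich j R \<longleftrightarrow> (\<exists>R1 R2. R1 \<subseteq> R \<and> R2 \<subseteq> R \<and> anticomplete E R1 R2 \<and>
     (\<forall>b. forcing E s j b R1 \<and> forcing E s j b R2))"

lemma rich_mono: "rich j R \<Longrightarrow> R \<subseteq> R' \<Longrightarrow> rich j R'"
  unfolding rich_def by (meson subset_trans)

lemma rich_node:
  assumes "level_forces E s n j" "node E s m b U" "Suc n < m"
  shows "rich j U"
proof -
  obtain m' where m': "m = Suc m'" "n < m'" using assms(3) by (cases m) auto
  from assms(2)[unfolded m'(1)] obtain y D1 D2 T1 T2 where n: "y \<in> U" "D1 \<subseteq> U" "D2 \<subseteq> U" "fork E y D1 D2"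
    "T1 \<subseteq> D1" "node E s m' b T1" "T2 \<subseteq> D2" "node E s m' (\<not> b) T2" by (rule node_SucE)
  have "forcing E s j c T1" "forcing E s j c T2" for c
    using level_forces_both[OF assms(1)] n(6,8) m'(2) by blast+
  moreover have "anticomplete E T1 T2" using n unfolding fork_def by (auto intro: anticomplete_mono)
  ultimately show ?thesis unfolding rich_def using n by (meson subset_trans)
qed

text \<open>A rich set is exactly what \<open>forcing_gain\<close> consumes: a vertex complete to
  its opposite side would force one more color.\<close>

lemma rich_not_complete:
  assumes "\<And>c. \<not> forcing E s (Suc j) c T" "rich j R" "R \<subseteq> T" "x \<in> T" "x \<notin> R"
  shows "\<exists>u\<in>R. s u \<noteq> s x \<and> \<not> E x u"
proof (rule ccontr)
  assume *: "\<not> ?thesis"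
  from assms(2) obtain R1 R2 where R: "R1 \<subseteq> R" "R2 \<subseteq> R" "anticomplete E R1 R2"
     "\<And>b. forcing E s j b R1" "\<And>b. forcing E s j b R2" unfolding rich_def by blast
  then have "forcing E s (Suc j) (s x) T"
    using * assms(3-5) by (intro forcing_gain[of x T R1 R2]) auto
  then show False using assms(1) by blast
qed

text \<open>A rich connected set at distance at least two from \<open>x\<close> gives a long path: the last vertex before
  the set is not complete to it.\<close>

lemma leg_5_avoid:
  assumes nf: "\<And>c. \<not> forcing E s (Suc j) c T" and D: "D \<subseteq> T" "conn E D" "x \<notin> D" "d \<in> D" "E x d"
    and R: "R \<subseteq> D" "conn E R" "rich j R" "R \<noteq> {}" and avoid: "\<And>r. r \<in> R \<Longrightarrow> \<not> E x r"
  shows "leg x D 5"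
proof -
  from R(4) obtain r where r: "r \<in> R" by blast
  obtain p where p: "ipath E p" "2 \<le> length p" "hd p = x" "last p = r" "set (tl p) \<subseteq> D"
    using ipath_into[OF D(2-5), of r] r R(1) by blast
  define Q where "Q i \<longleftrightarrow> i < length p \<and> (\<exists>r\<in>R. E (p ! i) r)" for i
  \<comment> \<open>The first path vertex with a neighbor in \<open>R\<close>. All path vertices up
    to it lie outside \<open>R\<close>, and \<open>x\<close> is not it by the assumption
    \<open>avoid\<close>.\<close>
  define i where "i = (LEAST i. Q i)"
  have "E (p ! (length p - 2)) (p ! Suc (length p - 2))" using p(2) by (intro ipath_Suc[OF p(1)]) simp
  moreover have "Suc (length p - 2) = length p - 1" "p \<noteq> []" using p(2) by auto
  then have "p ! Suc (length p - 2) = r" using p(4) by (simp add: last_conv_nth)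
  ultimately have "Q (length p - 2)" unfolding Q_def using p(2) r by auto
  then have Qi: "Q i" unfolding i_def by (rule LeastI)
  have least: "\<not> Q k" if "k < i" for k using not_less_Least that unfolding i_def by blast
  have p0: "p ! 0 = x" using p(2,3) by (cases p) auto
  have i0: "0 < i" using Qi avoid p0 unfolding Q_def by (cases i) auto
  have notR: "p ! k \<notin> R" if "k \<le> i" for k
  proof (cases k)
    case 0
    then show ?thesis using p0 D(3) R(1) by auto
  next
    case (Suc l)
    then have "l < i" "Suc l < length p" using that Qi unfolding Q_def by auto
    then show ?thesis using least[of l] ipath_Suc[OF p(1), of l] Suc unfolding Q_def by auto
  qed
  let ?u = "p ! i" and ?q = "take (Suc i) p"
  have i: "i < length p" using Qi unfolding Q_def by blast
  have "?u \<in> set (tl p)" using i0 i by (cases p; cases i) auto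
  then have "?u \<in> T" using p(5) D(1) by auto
  then obtain w where w: "w \<in> R" "s w \<noteq> s ?u" "\<not> E ?u w"
    using rich_not_complete[OF nf R(3), of ?u] R(1) D(1) notR[of i] by blast
  obtain r' where "r' \<in> R" "E ?u r'" using Qi unfolding Q_def by blast
  with leg_4[OF R(2) notR[of i] this w] obtain q where
    q: "ipath E q" "hd q = ?u" "set (tl q) \<subseteq> R" "length q = 4" unfolding leg_def by auto
  have last: "last ?q = ?u" "butlast ?q = take i p" using i by (auto simp: take_Suc_conv_app_nth)
  have "ipath E (?q @ tl q)"
  proof (rule ipath_append)
    show "ipath E ?q" using p(1) by (rule ipath_take)
    show "a \<noteq> b \<and> \<not> E a b" if ab: "a \<in> set (butlast ?q)" "b \<in> set (tl q)" for a b
    proof -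
      obtain k where k: "k < i" "a = p ! k" using ab(1) i unfolding last by (auto simp: in_set_conv_nth)
      then have "a \<notin> R" "\<not> Q k" using notR[of k] least[of k] by auto
      then show ?thesis using ab(2) q(3) k i unfolding Q_def by auto
    qed
  qed (use q p last in auto)
  \<comment> \<open>At least two vertices up to index \<open>i\<close>, plus the three further
    vertices of the leg into \<open>R\<close>.\<close>
  moreover have "hd (?q @ tl q) = x" "5 \<le> length (?q @ tl q)" using p i i0 q by (auto simp: hd_append)
  moreover have "set (tl (?q @ tl q)) \<subseteq> D"
    using p(2,5) q(3) R(1) by (cases p) (auto dest: in_set_takeD)
  ultimately show ?thesis by (intro legI) auto
qed

text \<open>A merging vertex both of whose components are rich. Only to joints can completeness be
  enforced, since a missed joint extends a path beyond it.\<close>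

definition joint :: "nat \<Rightarrow> 'a set \<Rightarrow> 'a \<Rightarrow> bool" where
  "joint j D z \<longleftrightarrow> z \<in> D \<and> (\<exists>J1 J2. J1 \<subseteq> D \<and> J2 \<subseteq> D \<and> fork E z J1 J2 \<and> rich j J1 \<and> rich j J2)"

lemma joint_mono: "joint j D z \<Longrightarrow> D \<subseteq> D' \<Longrightarrow> joint j D' z"
  unfolding joint_def by (meson subset_trans subsetD)

text \<open>If \<open>x\<close> has a neighbor in \<open>J1\<close>, an induced path through
  \<open>J1\<close> reaches \<open>z\<close> with at least four vertices, as \<open>z\<close> is a
  nonneighbor on the opposite side, and one step into \<open>J2\<close> adds the fifth. Otherwise
  \<open>x\<close> avoids the rich set \<open>J1\<close> altogether and \<open>leg_5_avoid\<close>
  applies.\<close>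

lemma leg_5_joint:
  assumes nf: "\<And>c. \<not> forcing E s (Suc j) c T" and D: "D \<subseteq> T" "conn E D" "x \<notin> D" "d \<in> D" "E x d"
    and z: "joint j D z" "s z \<noteq> s x" "\<not> E x z"
  shows "leg x D 5"
proof -
  from z(1) obtain J1 J2 where J: "z \<in> D" "J1 \<subseteq> D" "J2 \<subseteq> D" "fork E z J1 J2" "rich j J1" "rich j J2"
    unfolding joint_def by blast
  have hit: "leg x D 5" if h: "J1 \<subseteq> D" "J2 \<subseteq> D" "fork E z J1 J2" "a \<in> J1" "E x a" for J1 J2 a
  proof -
    have f: "z \<notin> J1" "z \<notin> J2" "conn E J1" "anticomplete E J1 J2" using that(3) unfolding fork_def by auto
    from that(3) obtain d1 d2 where d: "d1 \<in> J1" "E z d1" "d2 \<in> J2" "E z d2" unfolding fork_def by blast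
    have "x \<notin> insert z J1" using D(3) J(1) that(1) by auto
    moreover have "conn E (insert z J1)" using conn_insert[OF f(3) d(1,2)] .
    ultimately obtain p where p: "ipath E p" "2 \<le> length p" "hd p = x" "last p = z" "set (tl p) \<subseteq> insert z J1"
      "even (length p) = (s x \<noteq> s z)" using ipath_into[of "insert z J1" x a z] h(4,5) by blast
    have "length p \<noteq> 2"
    proof
      assume 2: "length p = 2"
      then have "E (p ! 0) (p ! 1)" using ipath_Suc[OF p(1), of 0] by simp
      then show False using p 2 z(3) by (simp add: last_conv_nth hd_conv_nth flip: length_0_conv)
    qed
    moreover have "length p \<noteq> 3" using p(6) z(2) by auto
    ultimately have len: "4 \<le> length p" using p(2) by linarith
    have pz: "z \<notin> set (butlast p)" using ipath_distinct[OF p(1)] p(4) len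
      by (metis append_butlast_last_id distinct_butlast not_distinct_conv_prefix list.size(3) not_numeral_le_zero)
    have "ipath E (p @ tl [z, d2])"
    proof (rule ipath_append)
      show "ipath E [z, d2]" using d f by auto
      show "a \<noteq> b \<and> \<not> E a b" if ab: "a \<in> set (butlast p)" "b \<in> set (tl [z, d2])" for a b
      proof (cases "a = x")
        case True
        \<comment> \<open>The end \<open>d2\<close> lies on the side of \<open>x\<close>, so the two
          are not adjacent. The remaining path vertices before \<open>z\<close> lie in
          \<open>J1\<close>, which is anticomplete to \<open>J2\<close>.\<close>
        have "s d2 = s x" using bip[OF d(4)] z(2) by auto
        then show ?thesis using True ab(2) d(3) \<open>J2 \<subseteq> D\<close> D(3) bip[of x d2] by auto
      next
        case False
        then have "a \<in> set (tl p)" using ab(1) p(3) len by (cases p) (auto dest: in_set_butlastD split: if_splits)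
        then have "a \<in> J1" using p(5) pz ab(1) by auto
        then show ?thesis using ab(2) d(3) f(4) unfolding anticomplete_def by auto
      qed
    qed (use p len in auto)
    moreover have "set (tl (p @ tl [z, d2])) \<subseteq> D" using p(5) len h(1,2) J(1) d(3) by (cases p) auto
    moreover have "hd (p @ tl [z, d2]) = x" using p(3) len by (cases p) auto
    ultimately show ?thesis using len by (intro legI) auto
  qed
  show ?thesis
  proof (cases "\<exists>a\<in>J1. E x a")
    case True
    then show ?thesis using hit J by blast
  next
    case False
    have "conn E J1" "J1 \<noteq> {}" using J(4) unfolding fork_def by auto
    then show ?thesis using leg_5_avoid[OF nf D J(2) _ J(5)] False by blast
  qed
qed

lemma P9_free_fork_joints:
  assumes nf: "\<And>c. \<not> forcing E s (Suc j) c T" and P9: "\<nexists>p. ipath E p \<and> length p = 9"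
    and D: "D1 \<subseteq> T" "D2 \<subseteq> T" "fork E x D1 D2"
  shows "(\<forall>z. joint j D1 z \<longrightarrow> s z \<noteq> s x \<longrightarrow> E x z) \<or> (\<forall>z. joint j D2 z \<longrightarrow> s z \<noteq> s x \<longrightarrow> E x z)"
proof (rule ccontr)
  assume "\<not> ?thesis"
  then have "leg x D1 5" "leg x D2 5"
    using leg_5_joint[OF nf D(1)] leg_5_joint[OF nf D(2)] D(3) unfolding fork_def by blast+
  then show False using legs_join[of x D1 5 D2 5] P9 D(3) unfolding fork_def by simp
qed

text \<open>If \<open>T\<close> does not force \<open>j + 1\<close> colors, all nodes above level \<open>n\<close> in \<open>T\<close> are ties, so their forks lie on the
  sides they vote for, and the joints alone carry a forcing structure.\<close>

lemma tie_region_forcing: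
  assumes nf: "\<And>c. \<not> forcing E s (Suc j) c T" and P9: "\<nexists>p. ipath E p \<and> length p = 9"
    and lf: "level_forces E s n j"
  shows "node E s (n + 3 + 2 * i) b U \<Longrightarrow> U \<subseteq> T \<Longrightarrow> forcing E s (Suc i) b {z. joint j U z}"
proof (induction i arbitrary: b U)
  \<comment> \<open>Above level \<open>n\<close> both sides force \<open>j\<close> colors by
    \<open>level_forces_both\<close>, and by \<open>nf\<close> neither forces more.\<close>
  have tie: "strong E s b U" if "node E s m c U" "n < m" "U \<subseteq> T" for m b c U
    unfolding strong_def
  proof (intro allI impI)
    fix k assume "forcing E s k (\<not> b) U"
    then have "k \<le> j" using nf forcing_mono[OF _ that(3)] forcing_antimono[of E s k "\<not> b" T "Suc j"]
      by (metis not_less_eq_eq)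
    then show "forcing E s k b U" using level_forces_both[OF lf that(1,2)] forcing_antimono by blast
  qed
  {
    case 0
    then have "node E s (Suc (n + 2)) b U" by (simp add: numeral_3_eq_3)
    then obtain x D1 D2 T1 T2 where n: "x \<in> U" "D1 \<subseteq> U" "D2 \<subseteq> U" "fork E x D1 D2" "strong E s (\<not> b) U \<longrightarrow> s x = b"
      "T1 \<subseteq> D1" "node E s (n + 2) b T1" "T2 \<subseteq> D2" "node E s (n + 2) (\<not> b) T2" by (rule node_SucE)
    \<comment> \<open>Richness needs children of level \<open>n + 2\<close>, hence the
      \<open>3\<close> in the statement.\<close>
    have "rich j D1" "rich j D2" using rich_node[OF lf] n(6-9) rich_mono by (metis add_2_eq_Suc' lessI)+
    then have "joint j U x" unfolding joint_def using n by blast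
    moreover have "s x = b" using n(5) tie[OF 0(1), of "\<not> b"] 0(2) by simp
    ultimately show ?case by (intro forcing_one) auto
  next
    case (Suc i)
    let ?m = "n + 3 + 2 * i"
    from Suc.prems have "node E s (Suc (Suc ?m)) b U" by simp
    then obtain x D1 D2 T1 T2 where n: "x \<in> U" "D1 \<subseteq> U" "D2 \<subseteq> U" "fork E x D1 D2" "strong E s (\<not> b) U \<longrightarrow> s x = b"
      "T1 \<subseteq> D1" "node E s (Suc ?m) b T1" "T2 \<subseteq> D2" "node E s (Suc ?m) (\<not> b) T2" by (rule node_SucE)
    have "rich j D1" "rich j D2"
      using rich_node[OF lf n(7)] rich_node[OF lf n(9)] n(6,8) rich_mono by auto
    then have x: "joint j U x" unfolding joint_def using n by blast
    have sx: "s x = b" using n(5) tie[OF Suc.prems(1), of "\<not> b"] Suc.prems(2) by simp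
    \<comment> \<open>Grandchildren with both votes are taken in each component, so each step costs
      two levels. If the color sets differ, \<open>U1\<close> and \<open>V2\<close> from different
      components are used. If they agree, the two grandchildren in the component to whose joints
      \<open>x\<close> is complete are used.\<close>
    from n(7) obtain y1 C1 C2 U1 U2 where U: "C1 \<subseteq> T1" "C2 \<subseteq> T1" "fork E y1 C1 C2"
      "U1 \<subseteq> C1" "node E s ?m b U1" "U2 \<subseteq> C2" "node E s ?m (\<not> b) U2" by (rule node_SucE)
    from n(9) obtain y2 B1 B2 V1 V2 where V: "B1 \<subseteq> T2" "B2 \<subseteq> T2" "fork E y2 B1 B2"
      "V1 \<subseteq> B1" "node E s ?m (\<not> b) V1" "V2 \<subseteq> B2" "node E s ?m (\<not> \<not> b) V2" by (rule node_SucE)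
    let ?F = "\<lambda>U. {z. joint j U z}"
    have F: "?F A \<subseteq> A" for A unfolding joint_def by blast
    have mono: "?F A \<subseteq> ?F B" if "A \<subseteq> B" for A B using joint_mono that by blast
    have sub: "U1 \<subseteq> D1" "U2 \<subseteq> D1" "V1 \<subseteq> D2" "V2 \<subseteq> D2" "U1 \<subseteq> U" "U2 \<subseteq> U" "V1 \<subseteq> U" "V2 \<subseteq> U"
      using U V n(2,3,6,8) by blast+
    have IH: "forcing E s (Suc i) b (?F U1)" "forcing E s (Suc i) (\<not> b) (?F U2)"
      "forcing E s (Suc i) (\<not> b) (?F V1)" "forcing E s (Suc i) b (?F V2)"
      using Suc.IH[OF U(5)] Suc.IH[OF U(7)] Suc.IH[OF V(5)] Suc.IH[OF V(7)] sub Suc.prems(2) by auto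
    have anti: "anticomplete E (?F U1) (?F U2)" "anticomplete E (?F V2) (?F V1)" "anticomplete E (?F U1) (?F V2)"
      using U(3,4,6) V(3,4,6) n(4) sub(1,4) F anticomplete_sym unfolding fork_def
      by (meson anticomplete_mono subset_trans)+
    have D: "D1 \<subseteq> T" "D2 \<subseteq> T" "x \<notin> D1" "x \<notin> D2" using n(2-4) Suc.prems(2) unfolding fork_def by auto
    show ?case
      unfolding forcing.simps(2)[of E s "Suc i"]
    proof (intro conjI)
      show "\<exists>T1 T2. T1 \<subseteq> ?F U \<and> T2 \<subseteq> ?F U \<and> anticomplete E T1 T2 \<and> forcing E s (Suc i) b T1 \<and>
          forcing E s (Suc i) b T2"
        using IH anti mono sub by blast
      have gain: "\<exists>x T1 T2. x \<in> ?F U \<and> s x = b \<and> T1 \<subseteq> ?F U \<and> T2 \<subseteq> ?F U \<and> x \<notin> T1 \<and> x \<notin> T2 \<and>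
          anticomplete E T1 T2 \<and> forcing E s (Suc i) b T1 \<and> forcing E s (Suc i) (\<not> b) T2 \<and>
          (\<forall>u\<in>T1 \<union> T2. s u \<noteq> b \<longrightarrow> E x u)"
        if "A1 \<subseteq> D" "A2 \<subseteq> D" "D \<subseteq> U" "x \<notin> D" "forcing E s (Suc i) b (?F A1)"
          "forcing E s (Suc i) (\<not> b) (?F A2)" "anticomplete E (?F A1) (?F A2)"
          "\<forall>z. joint j D z \<longrightarrow> s z \<noteq> s x \<longrightarrow> E x z" for A1 A2 D
      proof (intro exI conjI)
        show "x \<in> ?F U" using x by simp
        show "?F A1 \<subseteq> ?F U" "?F A2 \<subseteq> ?F U" using that(1-3) mono by (meson subset_trans)+
        show "x \<notin> ?F A1" "x \<notin> ?F A2" using that(1,2,4) F by blast+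
        show "\<forall>u\<in>?F A1 \<union> ?F A2. s u \<noteq> b \<longrightarrow> E x u" using that(1,2,8) mono sx by blast
      qed (use sx that in auto)
      show "\<exists>x T1 T2. x \<in> ?F U \<and> s x = b \<and> T1 \<subseteq> ?F U \<and> T2 \<subseteq> ?F U \<and> x \<notin> T1 \<and> x \<notin> T2 \<and>
          anticomplete E T1 T2 \<and> forcing E s (Suc i) b T1 \<and> forcing E s (Suc i) (\<not> b) T2 \<and>
          (\<forall>u\<in>T1 \<union> T2. s u \<noteq> b \<longrightarrow> E x u)"
        using P9_free_fork_joints[OF nf P9 D(1,2) n(4)]
      proof
        assume "\<forall>z. joint j D1 z \<longrightarrow> s z \<noteq> s x \<longrightarrow> E x z"
        then show ?thesis by (rule gain[OF sub(1,2) n(2) D(3) IH(1,2) anti(1)])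
      next
        assume "\<forall>z. joint j D2 z \<longrightarrow> s z \<noteq> s x \<longrightarrow> E x z"
        then show ?thesis by (rule gain[OF sub(4,3) n(3) D(4) IH(4,3) anti(2)])
      qed
    qed
  }
qed

text \<open>If \<open>j + 1\<close> colors were not forced, the ties in the next
  \<open>2 * j + 3\<close> levels would let the joints alone force \<open>j + 1\<close> colors, a
  contradiction.\<close>

lemma P9_free_level_step:
  assumes "\<nexists>p. ipath E p \<and> length p = 9" "level_forces E s n j"
  shows "level_forces E s (n + 2 * j + 3) (Suc j)"
  unfolding level_forces_def
proof (intro allI impI)
  fix b T assume node: "node E s (n + 2 * j + 3) b T"
  show "\<exists>c. forcing E s (Suc j) c T"
  proof (rule ccontr)
    assume nf: "\<nexists>c. forcing E s (Suc j) c T"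
    then have "forcing E s (Suc j) b {z. joint j T z}"
      using tie_region_forcing[OF _ assms, of T j b T] node by (simp add: add_ac)
    moreover have "{z. joint j T z} \<subseteq> T" unfolding joint_def by blast
    ultimately show False using nf forcing_mono by blast
  qed
qed

end

section \<open>The bicoloring algorithm\<close>

definition edges_upto :: "(nat \<Rightarrow> nat \<Rightarrow> bool) \<Rightarrow> nat \<Rightarrow> (nat \<times> nat) set" where
  "edges_upto E t = {(i, j). E i j \<and> i \<le> t \<and> j \<le> t}"

text \<open>The component at the arrival of \<open>t\<close>, not in the final graph.\<close>

definition component :: "(nat \<Rightarrow> nat \<Rightarrow> bool) \<Rightarrow> nat \<Rightarrow> nat set" where
  "component E t = {u. (t, u) \<in> (edges_upto E t)\<^sup>*}"

text \<open>A vertex colored \<open>(i, c)\<close> votes for its own side if \<open>c\<close> holds and for the opposite side otherwise.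
  The new vertex \<open>t\<close> gets the least index from which on all votes in its component agree. On a fresh index
  it votes for a side on which the component forces at least as many colors as on the other one, and for
  its own side in case of a tie. The membership \<open>(t, u) \<in> (R O R)\<^sup>*\<close> says that \<open>u\<close> lies on the side of \<open>t\<close>.\<close>

definition bicolor_step :: "(nat \<times> nat) set \<Rightarrow> nat \<Rightarrow> (nat \<times> bool) list \<Rightarrow> nat \<times> bool" where
  "bicolor_step R t cs =
     (let C = {u. (t, u) \<in> R\<^sup>*}; side = (\<lambda>u. (t, u) \<in> (R O R)\<^sup>*);
          I = (\<lambda>i. {u \<in> C - {t}. fst (cs ! u) = i}); vote = (\<lambda>u. side u = snd (cs ! u));
          m = (LEAST m. \<forall>i\<ge>m. \<forall>u\<in>I i. \<forall>w\<in>I i. vote u = vote w)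
      in (m, if I m = {} then strong (\<lambda>i j. (i, j) \<in> R) side True C else \<exists>u\<in>I m. vote u))"

primrec bicolors :: "(nat \<Rightarrow> nat \<Rightarrow> bool) \<Rightarrow> nat \<Rightarrow> (nat \<times> bool) list" where
  "bicolors E 0 = []"
| "bicolors E (Suc t) = bicolors E t @ [bicolor_step (edges_upto E t) t (bicolors E t)]"

definition bicolor :: "(nat \<Rightarrow> nat \<Rightarrow> bool) \<Rightarrow> nat \<Rightarrow> nat \<times> bool" where
  "bicolor E t = bicolor_step (edges_upto E t) t (bicolors E t)"

lemma length_bicolors [simp]: "length (bicolors E t) = t"
  by (induction t) auto

lemma bicolors_nth: "u < t \<Longrightarrow> bicolors E t ! u = bicolor E u"
  by (induction t) (auto simp: nth_append bicolor_def less_Suc_eq)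

lemma edges_upto_cong: "(\<And>i j. i \<le> t \<Longrightarrow> j \<le> t \<Longrightarrow> E i j = E' i j) \<Longrightarrow> edges_upto E t = edges_upto E' t"
  unfolding edges_upto_def by auto

lemma bicolors_cong: "(\<And>i j. i < t \<Longrightarrow> j < t \<Longrightarrow> E i j = E' i j) \<Longrightarrow> bicolors E t = bicolors E' t"
proof (induction t)
  case (Suc t)
  then have "edges_upto E t = edges_upto E' t" by (intro edges_upto_cong) auto
  with Suc show ?case by auto
qed simp

text \<open>This is what makes the bicoloring online: the color depends only on edges among vertices
  that have arrived.\<close>

lemma bicolor_cong: "(\<And>i j. i \<le> t \<Longrightarrow> j \<le> t \<Longrightarrow> E i j = E' i j) \<Longrightarrow> bicolor E t = bicolor E' t"
  unfolding bicolor_def by (metis edges_upto_cong bicolors_cong less_imp_le)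

lemma edges_upto_mono: "u \<le> t \<Longrightarrow> edges_upto E u \<subseteq> edges_upto E t"
  unfolding edges_upto_def by auto

lemma component_self: "t \<in> component E t"
  by (simp add: component_def)

lemma component_le: "u \<in> component E t \<Longrightarrow> u \<le> t"
  unfolding component_def by (auto simp: edges_upto_def elim: rtranclE)

lemma component_mono: "u \<in> component E t \<Longrightarrow> component E u \<subseteq> component E t"
  using component_le[of u E t] rtrancl_mono[OF edges_upto_mono, of u t E] unfolding component_def by (auto intro: rtrancl_trans)

definition idx :: "(nat \<Rightarrow> nat \<Rightarrow> bool) \<Rightarrow> nat \<Rightarrow> nat" where
  "idx E t = fst (bicolor E t)"

text \<open>The side voted for, in terms of a fixed bipartition \<open>s\<close> of the whole graph.
  The algorithm knows sides only relative to the current vertex.\<close>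

definition vote :: "(nat \<Rightarrow> nat \<Rightarrow> bool) \<Rightarrow> (nat \<Rightarrow> bool) \<Rightarrow> nat \<Rightarrow> bool" where
  "vote E s t = (s t = snd (bicolor E t))"

lemma (in bipartition) conn_reachable:
  assumes "\<And>a b. (a, b) \<in> R \<Longrightarrow> E a b"
  shows "conn E {v. (u, v) \<in> R\<^sup>*}"
proof -
  let ?D = "{v. (u, v) \<in> R\<^sup>*}"
  let ?S = "{(a, b). a \<in> ?D \<and> b \<in> ?D \<and> E a b}"
  have 1: "(u, v) \<in> ?S\<^sup>*" if "(u, v) \<in> R\<^sup>*" for v
    using that
  proof (induction rule: rtrancl_induct)
    case (step v w)
    then have "(v, w) \<in> ?S" using assms by (auto intro: rtrancl_into_rtrancl)
    with step show ?case by (meson rtrancl_into_rtrancl)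
  qed simp
  have conv: "?S\<inverse> = ?S" using sym by auto
  have 2: "(v, u) \<in> ?S\<^sup>*" if "(u, v) \<in> R\<^sup>*" for v
    using rtrancl_converseI[OF 1[OF that]] unfolding conv .
  with 1 show ?thesis unfolding conn_def by (auto intro: rtrancl_trans)
qed

section \<open>Analysis of the bicoloring\<close>

locale arrival_bipartition = bipartition E s for E :: "nat \<Rightarrow> nat \<Rightarrow> bool" and s :: "nat \<Rightarrow> bool"
begin

lemma edges_upto_sym: "(a, b) \<in> edges_upto E t \<Longrightarrow> (b, a) \<in> edges_upto E t"
  using sym by (auto simp: edges_upto_def)

lemma edges_upto_rtrancl_sym: "(a, b) \<in> (edges_upto E t)\<^sup>* \<Longrightarrow> (b, a) \<in> (edges_upto E t)\<^sup>*"
  by (induction rule: rtrancl_induct) (auto intro: converse_rtrancl_into_rtrancl edges_upto_sym)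

text \<open>Walks of even length stay on the side of \<open>t\<close>. The induction also follows
  the walks of odd length, which lead to the opposite side.\<close>

lemma side_iff:
  assumes "u \<in> component E t"
  shows "(t, u) \<in> (edges_upto E t O edges_upto E t)\<^sup>* \<longleftrightarrow> s u = s t"
proof -
  let ?R = "edges_upto E t"
  have flip: "s a \<noteq> s b" if "(a, b) \<in> ?R" for a b using that bip by (auto simp: edges_upto_def)
  have "s v = s t" if "(t, v) \<in> (?R O ?R)\<^sup>*" for v
    using that by (induction rule: rtrancl_induct) (use flip in blast)+
  moreover have "(t, v) \<in> (?R O ?R)\<^sup>* \<and> s v = s t \<or> (t, v) \<in> (?R O ?R)\<^sup>* O ?R \<and> s v \<noteq> s t"
    if "(t, v) \<in> ?R\<^sup>*" for v
    using that
  proof (induction rule: rtrancl_induct)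
    case (step v w)
    from step(3) show ?case
    proof
      assume "(t, v) \<in> (?R O ?R)\<^sup>* \<and> s v = s t"
      then show ?thesis using step(2) flip[OF step(2)] by auto
    next
      assume v: "(t, v) \<in> (?R O ?R)\<^sup>* O ?R \<and> s v \<noteq> s t"
      then obtain y where "(t, y) \<in> (?R O ?R)\<^sup>*" "(y, v) \<in> ?R" by blast
      then have "(t, w) \<in> (?R O ?R)\<^sup>*" using step(2) by (meson relcompI rtrancl_into_rtrancl)
      then show ?thesis using v flip[OF step(2)] by auto
    qed
  qed simp
  ultimately show ?thesis using assms unfolding component_def by blast
qed

text \<open>The interface to the analysis of votes: no conflict at or above the chosen index,
  agreement on an index already present, the rule for a fresh index, and a conflict just below the
  chosen index.\<close>

lemma bicolor_spec:
  shows "\<lbrakk>u \<in> component E t; u \<noteq> t; w \<in> component E t; w \<noteq> t; idx E u = idx E w; idx E t \<le> idx E u\<rbrakk>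
      \<Longrightarrow> vote E s u = vote E s w"
    and "\<lbrakk>u \<in> component E t; u \<noteq> t; idx E u = idx E t\<rbrakk> \<Longrightarrow> vote E s u = vote E s t"
    and "(\<And>u. u \<in> component E t \<Longrightarrow> u \<noteq> t \<Longrightarrow> idx E u \<noteq> idx E t) \<Longrightarrow>
      snd (bicolor E t) = strong E s (s t) (component E t)"
    and "idx E t = Suc m \<Longrightarrow> \<exists>u w. u \<in> component E t \<and> u \<noteq> t \<and> w \<in> component E t \<and> w \<noteq> t \<and>
      idx E u = m \<and> idx E w = m \<and> vote E s u \<noteq> vote E s w"
proof -
  let ?C = "component E t" and ?side = "\<lambda>u. (t, u) \<in> (edges_upto E t O edges_upto E t)\<^sup>*"
  define V where "V u = (?side u = snd (bicolor E u))" for u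
  define I where "I i = {u \<in> ?C - {t}. idx E u = i}" for i
  define Q where "Q m \<longleftrightarrow> (\<forall>i\<ge>m. \<forall>u\<in>I i. \<forall>w\<in>I i. V u = V w)" for m
  have lt: "u < t" if "u \<in> ?C - {t}" for u using that component_le[of u E t] by auto
  have nth: "bicolors E t ! u = bicolor E u" if "u \<in> ?C - {t}" for u using lt[OF that] bicolors_nth by blast
  have V: "V u = (vote E s u = s t)" if "u \<in> ?C - {t}" for u
    using side_iff[of u t] that unfolding V_def vote_def by auto
  have I': "{u \<in> ?C - {t}. fst (bicolors E t ! u) = i} = I i" for i
    unfolding I_def idx_def using nth by auto
  have V': "(?side u = snd (bicolors E t ! u)) = V u" if "u \<in> I i" for u i
    using nth that unfolding V_def I_def by auto
  \<comment> \<open>The algorithm measures sides relative to \<open>t\<close>; its value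
    \<open>True\<close> corresponds to \<open>s t\<close>.\<close>
  have strong: "strong (\<lambda>i j. (i, j) \<in> edges_upto E t) ?side True ?C = strong E s (s t) ?C"
  proof -
    have "forcing (\<lambda>i j. (i, j) \<in> edges_upto E t) ?side k b ?C = forcing E s k (b = s t) ?C" for k b
      using side_iff[of _ t] component_le[of _ E t] by (intro forcing_cong) (auto simp: edges_upto_def)
    then show ?thesis unfolding strong_def by (cases "s t") auto
  qed
  have step: "bicolor E t = (LEAST m. Q m, if I (LEAST m. Q m) = {} then strong E s (s t) ?C
      else \<exists>u\<in>I (LEAST m. Q m). V u)"
    unfolding bicolor_def bicolor_step_def Let_def component_def[symmetric] I' strong Q_def
    using V' by (simp cong: ball_cong bex_cong)
  have "?C - {t} \<subseteq> {..<t}" using lt by auto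
  then have "finite (idx E ` (?C - {t}))" by (rule finite_imageI[OF finite_subset]) simp
  \<comment> \<open>Beyond all indices used so far there is nothing to disagree, so the
    \<open>LEAST\<close> exists.\<close>
  then obtain m0 where "\<forall>n\<in>idx E ` (?C - {t}). n < m0" unfolding finite_nat_set_iff_bounded by blast
  then have "I i = {}" if "i \<ge> m0" for i using that unfolding I_def by (auto simp: linorder_not_le[symmetric])
  then have "Q m0" unfolding Q_def by auto
  then have Q: "Q (idx E t)" unfolding idx_def step fst_conv by (rule LeastI)
  have least: "\<not> Q m" if "m < idx E t" for m
    using not_less_Least[of m Q] that unfolding idx_def step fst_conv by blast
  have snd: "snd (bicolor E t) = (if I (idx E t) = {} then strong E s (s t) ?C else \<exists>u\<in>I (idx E t). V u)"
    unfolding idx_def step by simp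
  show 1: "vote E s u = vote E s w" if "u \<in> ?C" "u \<noteq> t" "w \<in> ?C" "w \<noteq> t" "idx E u = idx E w" "idx E t \<le> idx E u" for u w
  proof -
    have "u \<in> I (idx E u)" "w \<in> I (idx E u)" unfolding I_def using that by auto
    then have "V u = V w" using Q that(6) unfolding Q_def by blast
    then show ?thesis using V that by auto
  qed
  show "vote E s u = vote E s t" if "u \<in> ?C" "u \<noteq> t" "idx E u = idx E t" for u
  proof -
    have u: "u \<in> I (idx E t)" unfolding I_def using that by auto
    have "V w = V u" if "w \<in> I (idx E t)" for w using Q u that unfolding Q_def by blast
    then have "(\<exists>w\<in>I (idx E t). V w) = V u" using u by blast
    moreover have "I (idx E t) \<noteq> {}" using u by auto
    ultimately have "snd (bicolor E t) = V u" unfolding snd by simp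
    then show ?thesis using V[of u] that unfolding vote_def[of E s t] by auto
  qed
  show "snd (bicolor E t) = strong E s (s t) ?C" if "\<And>u. u \<in> ?C \<Longrightarrow> u \<noteq> t \<Longrightarrow> idx E u \<noteq> idx E t"
    unfolding snd using that unfolding I_def by auto
  show "\<exists>u w. u \<in> ?C \<and> u \<noteq> t \<and> w \<in> ?C \<and> w \<noteq> t \<and> idx E u = m \<and> idx E w = m \<and> vote E s u \<noteq> vote E s w"
    if m: "idx E t = Suc m"
  proof -
    \<comment> \<open>Minimality makes \<open>m\<close> inadmissible, while from
      \<open>Suc m\<close> on there is no conflict; so the conflict sits at \<open>m\<close>
      itself.\<close>
    obtain i u w where i: "i \<ge> m" "u \<in> I i" "w \<in> I i" "V u \<noteq> V w"
      using least[of m] m unfolding Q_def by auto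
    have "i = m"
    proof (rule ccontr)
      assume "i \<noteq> m"
      then have "idx E t \<le> i" using i(1) m by simp
      then show False using Q i(2-4) unfolding Q_def by blast
    qed
    moreover have "u \<in> ?C - {t}" "w \<in> ?C - {t}" using i(2,3) unfolding I_def by auto
    ultimately show ?thesis using i V unfolding I_def by blast
  qed
qed

text \<open>Equal indices in one component mean equal votes, and equal votes with equal second
  entries mean equal sides.\<close>

lemma bicolor_proper:
  assumes "E t u" "u < t"
  shows "bicolor E t \<noteq> bicolor E u"
proof
  assume eq: "bicolor E t = bicolor E u"
  have "(t, u) \<in> edges_upto E t" using assms by (auto simp: edges_upto_def)
  then have "u \<in> component E t" unfolding component_def by auto
  then have "vote E s u = vote E s t" using bicolor_spec(2)[of u t] assms eq by (simp add: idx_def)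
  then show False using eq bip[OF assms(1)] unfolding vote_def by auto
qed

text \<open>A single vertex forces a color on its own side only. On an edgeless graph the bicoloring
  therefore uses one color, which matters there because the chromatic number is 1.\<close>

lemma bicolor_isolated:
  assumes "\<And>u. u < t \<Longrightarrow> \<not> E t u"
  shows "bicolor E t = (0, True)"
proof -
  have "\<not> E t t" using bip by blast
  then have "(t, v) \<notin> edges_upto E t" for v using assms unfolding edges_upto_def by (auto simp: le_less)
  then have C: "component E t = {t}" unfolding component_def by (auto elim: converse_rtranclE)
  have "idx E t = 0" using bicolor_spec(4)[of t] unfolding C by (cases "idx E t") auto
  moreover have "strong E s (s t) {t}"
    unfolding strong_def
  proof (intro allI impI)
    fix k assume "forcing E s k (\<not> s t) {t}"
    then have "k = 0" using forcing_nonempty_side[of k "\<not> s t" "{t}"] by auto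
    then show "forcing E s k (s t) {t}" by simp
  qed
  then have "snd (bicolor E t) = True" using bicolor_spec(3)[of t] unfolding C by auto
  ultimately show ?thesis unfolding idx_def by (metis prod.collapse)
qed

text \<open>At the first time when \<open>u\<close> and \<open>w\<close> are connected, the newest
  vertex must lie in their component, as otherwise they were connected one step earlier.\<close>

lemma merge_time:
  assumes "(u, w) \<in> {(i, j). E i j \<and> i < t \<and> j < t}\<^sup>*" "u < t" "w < t"
  shows "\<exists>r<t. u \<in> component E r \<and> w \<in> component E r"
proof -
  define Q where "Q r \<longleftrightarrow> (u, w) \<in> (edges_upto E r)\<^sup>* \<and> u \<le> r \<and> w \<le> r" for r
  define r where "r = (LEAST r. Q r)"
  have "{(i, j). E i j \<and> i < t \<and> j < t} = edges_upto E (t - 1)" using assms(2) by (auto simp: edges_upto_def)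
  then have "Q (t - 1)" unfolding Q_def using assms by auto
  then have Q: "Q r" and "r \<le> t - 1" unfolding r_def by (auto intro: LeastI Least_le)
  have "(u, r) \<in> (edges_upto E r)\<^sup>*"
  proof (rule ccontr)
    assume nr: "(u, r) \<notin> (edges_upto E r)\<^sup>*"
    have "(u, v) \<in> (edges_upto E (r - 1))\<^sup>*" if "(u, v) \<in> (edges_upto E r)\<^sup>*" for v
      using that
    proof (induction rule: rtrancl_induct)
      case (step v w)
      then have "v \<noteq> r" "w \<noteq> r" using nr by (auto intro: rtrancl_into_rtrancl)
      then have "(v, w) \<in> edges_upto E (r - 1)" using step(2) by (auto simp: edges_upto_def)
      with step show ?case by auto
    qed simp
    moreover have "u \<noteq> r" "w \<noteq> r" using nr Q unfolding Q_def by auto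
    ultimately have "Q (r - 1)" "r - 1 < r" using Q unfolding Q_def by auto
    then show False using not_less_Least[of "r - 1" Q] unfolding r_def by auto
  qed
  then have "(r, u) \<in> (edges_upto E r)\<^sup>*" by (rule edges_upto_rtrancl_sym)
  moreover from this have "(r, w) \<in> (edges_upto E r)\<^sup>*" using Q unfolding Q_def by (auto intro: rtrancl_trans)
  ultimately show ?thesis using \<open>r \<le> t - 1\<close> assms(2) unfolding component_def by (intro exI[of _ r]) auto
qed

text \<open>Links the algorithm to the merge trees. An index already present inherits the tree of an
  earlier vertex with the same vote. A fresh positive index comes from a conflict one index below,
  and its two witnesses supply the subtrees.\<close>

lemma bicolor_node: "\<exists>T\<subseteq>component E t. node E s (idx E t) (vote E s t) T"
proof (induction t rule: less_induct)
  case (less t)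
  let ?C = "component E t"
  have lt: "u < t" if "u \<in> ?C" "u \<noteq> t" for u using that component_le[of u E t] by auto
  show ?case
  proof (cases "\<exists>u. u \<in> ?C \<and> u \<noteq> t \<and> idx E u = idx E t")
    case True
    then obtain u where u: "u \<in> ?C" "u \<noteq> t" "idx E u = idx E t" by blast
    then have "vote E s u = vote E s t" by (rule bicolor_spec(2))
    then show ?thesis using less[OF lt[OF u(1,2)]] u(3) component_mono[OF u(1)] by auto
  next
    case False
    \<comment> \<open>A fresh index. If the side of \<open>t\<close> is not strong, some number of
      colors is forced on the other side only, so that side is strong and there is no tie.\<close>
    then have vt: "vote E s t = (if strong E s (s t) ?C then s t else \<not> s t)"
      using bicolor_spec(3)[of t] unfolding vote_def by auto
    have st: "strong E s (vote E s t) ?C"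
    proof (cases "strong E s (s t) ?C")
      case False
      then obtain k where k: "forcing E s k (\<not> s t) ?C" "\<not> forcing E s k (s t) ?C" unfolding strong_def by blast
      have "forcing E s j (\<not> s t) ?C" if "forcing E s j (s t) ?C" for j
        using that k forcing_antimono by (metis linear)
      then show ?thesis unfolding vt strong_def using False by simp
    qed (simp add: vt)
    have tie: "strong E s (\<not> vote E s t) ?C \<longrightarrow> s t = vote E s t" unfolding vt by auto
    show ?thesis
    proof (cases "idx E t")
      case 0
      then show ?thesis using st component_self[of t E] by (intro exI[of _ ?C]) auto
    next
      case (Suc m)
      from bicolor_spec(4)[OF Suc] obtain u w where uw: "u \<in> ?C" "u \<noteq> t" "w \<in> ?C" "w \<noteq> t" "idx E u = m" "idx E w = m"
        "vote E s u \<noteq> vote E s w" by blast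
      let ?R = "{(i, j). E i j \<and> i < t \<and> j < t}"
      let ?D = "\<lambda>u. {v. (u, v) \<in> ?R\<^sup>*}"
      have symR: "(b, a) \<in> ?R\<^sup>*" if "(a, b) \<in> ?R\<^sup>*" for a b
        using that by (induction rule: rtrancl_induct) (auto intro: converse_rtrancl_into_rtrancl sym)
      \<comment> \<open>The conflicting vertices cannot have met before \<open>t\<close>. At their
        first common time \<open>r\<close>, neither is \<open>r\<close> itself, since an index
        already present keeps its vote. So \<open>r\<close> moved above \<open>m\<close>, and beyond
        \<open>Suc m\<close> because that index is fresh at \<open>t\<close>. But then there was a
        conflict at an index of at least \<open>Suc m\<close> inside the component of
        \<open>t\<close>, contrary to the choice for \<open>t\<close>.\<close>
      have "(u, w) \<notin> ?R\<^sup>*"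
      proof
        assume "(u, w) \<in> ?R\<^sup>*"
        from merge_time[OF this] obtain r where r: "r < t" "u \<in> component E r" "w \<in> component E r"
          using lt uw by blast
        consider "r = u" | "r = w" | "r \<noteq> u" "r \<noteq> w" by blast
        then show False
        proof cases
          case 1
          then show False using bicolor_spec(2)[of w u] r(3) uw by fastforce
        next
          case 2
          then show False using bicolor_spec(2)[of u w] r(2) uw by fastforce
        next
          case 3
          then have "\<not> idx E r \<le> m" using bicolor_spec(1)[of u r w] r uw by auto
          moreover have "r \<in> ?C"
          proof -
            have "(u, r) \<in> (edges_upto E t)\<^sup>*"
              using r edges_upto_rtrancl_sym rtrancl_mono[OF edges_upto_mono[of r t E]] unfolding component_def by auto
            then show ?thesis using uw(1) unfolding component_def by (auto intro: rtrancl_trans)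
          qed
          then have "idx E r \<noteq> Suc m" using False Suc r(1) by auto
          ultimately obtain q where q: "idx E r = Suc q" "Suc m \<le> q" by (cases "idx E r") auto
          from bicolor_spec(4)[OF q(1)] obtain a b where ab: "a \<in> component E r" "a \<noteq> r" "b \<in> component E r"
            "b \<noteq> r" "idx E a = q" "idx E b = q" "vote E s a \<noteq> vote E s b" by blast
          have "a \<in> ?C" "b \<in> ?C" "a < t" "b < t"
            using ab component_mono[OF \<open>r \<in> ?C\<close>] component_le[of a E r] component_le[of b E r] r(1) by auto
          then show False using bicolor_spec(1)[of a t b] ab q(2) Suc by auto
        qed
      qed
      then have "?D u \<inter> ?D w = {}" using symR by (auto intro: rtrancl_trans)
      moreover have "\<not> E a b" if "a \<in> ?D u" "b \<in> ?D w" for a b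
      proof
        assume "E a b"
        moreover have "a < t" "b < t" using that lt uw by (auto elim: rtranclE)
        ultimately have "(u, b) \<in> ?R\<^sup>*" using that(1) by (auto intro: rtrancl_into_rtrancl)
        then show False using that(2) \<open>(u, w) \<notin> ?R\<^sup>*\<close> symR by (auto intro: rtrancl_trans)
      qed
      ultimately have anti: "anticomplete E (?D u) (?D w)" unfolding anticomplete_def using sym by blast
      have conn: "conn E (?D v)" for v by (rule conn_reachable) auto
      have adj: "\<exists>d\<in>?D v. E t d" if "v \<in> ?C" "v \<noteq> t" for v
      proof -
        have "v = t \<or> (\<exists>d. E t d \<and> (d, v) \<in> ?R\<^sup>*)" if "(t, v) \<in> (edges_upto E t)\<^sup>*" for v
          using that
        proof (induction rule: rtrancl_induct)
          case (step v w)
          then have vw: "E v w" "v \<le> t" "w \<le> t" by (auto simp: edges_upto_def)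
          show ?case
          proof (cases "v = t \<or> w = t")
            case False
            then have "(v, w) \<in> ?R" using vw by auto
            then show ?thesis using step(3) False by (meson rtrancl_into_rtrancl)
          qed (use vw in auto)
        qed simp
        then show ?thesis using that symR unfolding component_def by blast
      qed
      have notin: "t \<notin> ?D v" if "v \<noteq> t" for v
        using that by (auto elim: rtranclE)
      have DC: "?D v \<subseteq> ?C" if "v \<in> ?C" for v
      proof -
        have "?R\<^sup>* \<subseteq> (edges_upto E t)\<^sup>*" by (intro rtrancl_mono) (auto simp: edges_upto_def)
        then show ?thesis using that unfolding component_def by (auto intro: rtrancl_trans)
      qed
      have CD: "component E v \<subseteq> ?D v" if "v < t" for v
      proof -
        have "edges_upto E v \<subseteq> ?R" using that by (auto simp: edges_upto_def)
        then show ?thesis unfolding component_def using rtrancl_mono by blast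
      qed
      have sub: "\<exists>T\<subseteq>?D v. node E s m (vote E s v) T" if "v \<in> ?C" "v \<noteq> t" "idx E v = m" for v
        using less[OF lt[OF that(1,2)]] CD[OF lt[OF that(1,2)]] that(3) by (meson subset_trans)
      have main: "node E s (Suc m) (vote E s t) ?C"
        if h: "u \<in> ?C" "u \<noteq> t" "w \<in> ?C" "w \<noteq> t" "idx E u = m" "idx E w = m" "vote E s u = vote E s t"
          "vote E s w = (\<not> vote E s t)" "anticomplete E (?D u) (?D w)" for u w
      proof -
        obtain T1 where T1: "T1 \<subseteq> ?D u" "node E s m (vote E s t) T1"
          using sub[OF h(1,2,5)] unfolding h(7) by blast
        obtain T2 where T2: "T2 \<subseteq> ?D w" "node E s m (\<not> vote E s t) T2"
          using sub[OF h(3,4,6)] unfolding h(8) by blast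
        have "fork E t (?D u) (?D w)"
          unfolding fork_def
          by (intro conjI notin[OF h(2)] notin[OF h(4)] conn adj[OF h(1,2)] adj[OF h(3,4)] h(9))
        then show ?thesis unfolding node.simps
          using st tie component_self[of t E] DC[OF h(1)] DC[OF h(3)] T1 T2
          by (intro conjI exI[of _ t] exI[of _ "?D u"] exI[of _ "?D w"] exI[of _ T1] exI[of _ T2]) assumption+
      qed
      have "node E s (Suc m) (vote E s t) ?C"
      proof (cases "vote E s u = vote E s t")
        case True
        then show ?thesis using main[OF uw(1-6) True _ anti] uw(7) by blast
      next
        case False
        then show ?thesis using main[OF uw(3,4,1,2,6,5) _ _ anticomplete_sym[OF anti]] uw(7) by blast
      qed
      then show ?thesis unfolding Suc by blast
    qed
  qed
qed

end

section \<open>Bounds on the number of colors\<close>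

lemma (in arrival_bipartition) card_bicolor_le:
  assumes "\<And>t. t < n \<Longrightarrow> idx E t < L"
  shows "card (bicolor E ` {..<n}) \<le> 2 * L"
proof -
  have "bicolor E ` {..<n} \<subseteq> {..<L} \<times> UNIV"
    using assms unfolding idx_def by (simp add: image_subset_iff mem_Times_iff)
  then have "card (bicolor E ` {..<n}) \<le> card ({..<L} \<times> (UNIV :: bool set))" by (intro card_mono) auto
  then show ?thesis by (simp add: card_cartesian_product)
qed

text \<open>Starting from two colors at level 1 rather than one at level 0 is what makes the bound
  exact for the claimed value.\<close>

lemma (in bipartition) P6_free_levels:
  assumes "\<nexists>p. ipath E p \<and> length p = 6"
  shows "level_forces E s (2 * i + 1) (Suc (Suc i))"
proof (induction i)
  case (Suc i)
  then show ?case using P6_free_level_step[OF assms Suc] by simp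
qed (use level_1 in simp)

lemma (in bipartition) P7_free_levels:
  assumes "\<nexists>p. ipath E p \<and> length p = 7"
  shows "level_forces E s (3 * i + 1) (Suc (Suc i))"
proof (induction i)
  case (Suc i)
  then show ?case using P7_free_level_step[OF assms Suc] by (simp add: add_ac)
qed (use level_1 in simp)

text \<open>Solves the recurrence a(0) = 0, a(j + 1) = a(j) + 2 (j + 1) + 3 for the level at which
  \<open>j + 1\<close> colors are forced.\<close>

lemma (in bipartition) P9_free_levels:
  assumes "\<nexists>p. ipath E p \<and> length p = 9"
  shows "level_forces E s (j ^ 2 + 4 * j) (Suc j)"
proof (induction j)
  case (Suc j)
  have "j ^ 2 + 4 * j + 2 * Suc j + 3 = (Suc j) ^ 2 + 4 * Suc j" by (simp add: power2_eq_square)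
  then show ?case using P9_free_level_step[OF assms Suc] by (simp only:)
qed (use level_0 in simp)

lemma (in bipartition) no_longer_ipath:
  "\<nexists>p. ipath E p \<and> length p = m \<Longrightarrow> m \<le> n \<Longrightarrow> \<nexists>p. ipath E p \<and> length p = n"
  by (metis ipath_take length_take min.absorb2)

section \<open>First fit inside the prediction classes\<close>

primrec fit_levels :: "(nat \<Rightarrow> nat \<Rightarrow> bool) \<Rightarrow> (nat \<Rightarrow> 'c) \<Rightarrow> nat \<Rightarrow> nat list" where
  "fit_levels E P 0 = []"
| "fit_levels E P (Suc t) = fit_levels E P t @
     [LEAST l. \<forall>u<t. E u t \<longrightarrow> P u = P t \<longrightarrow> fit_levels E P t ! u \<noteq> l]"

definition fit_level :: "(nat \<Rightarrow> nat \<Rightarrow> bool) \<Rightarrow> (nat \<Rightarrow> 'c) \<Rightarrow> nat \<Rightarrow> nat" where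
  "fit_level E P t = fit_levels E P (Suc t) ! t"

definition fit_color :: "(nat \<Rightarrow> nat \<Rightarrow> bool) \<Rightarrow> (nat \<Rightarrow> 'c) \<Rightarrow> nat \<Rightarrow> 'c \<times> nat" where
  "fit_color E P t = (P t, fit_level E P t)"

lemma length_fit_levels [simp]: "length (fit_levels E P t) = t"
  by (induction t) auto

lemma fit_levels_nth: "u < t \<Longrightarrow> fit_levels E P t ! u = fit_level E P u"
proof (induction t)
  case (Suc t)
  show ?case
  proof (cases "u = t")
    case False
    then have "u < t" using Suc.prems by simp
    then show ?thesis using Suc.IH by (simp add: nth_append)
  qed (simp add: fit_level_def)
qed simp

lemma fit_level_Least: "fit_level E P t = (LEAST l. \<forall>u<t. E u t \<longrightarrow> P u = P t \<longrightarrow> fit_level E P u \<noteq> l)"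
  unfolding fit_level_def[of E P t] by (simp add: nth_append fit_levels_nth cong: imp_cong)

lemma fit_level_cong:
  assumes "\<And>i j. i \<le> t \<Longrightarrow> j \<le> t \<Longrightarrow> E i j = E' i j" "\<And>i. i \<le> t \<Longrightarrow> P i = P' i"
  shows "fit_level E P t = fit_level E' P' t"
  using assms
proof (induction t rule: less_induct)
  case (less t)
  have "fit_level E P u = fit_level E' P' u" if "u < t" for u using less that by auto
  then show ?case unfolding fit_level_Least[of E P t] fit_level_Least[of E' P' t]
    using less.prems by (intro arg_cong[where f = Least]) (auto simp: fun_eq_iff)
qed

lemma fit_level_proper:
  assumes "E u t" "u < t" "P u = P t"
  shows "fit_level E P u \<noteq> fit_level E P t"
proof -
  obtain m where "\<forall>n\<in>fit_level E P ` {..<t}. n < m" using finite_nat_set_iff_bounded by blast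
  then have "\<forall>u<t. E u t \<longrightarrow> P u = P t \<longrightarrow> fit_level E P u \<noteq> m" by auto
  then have "\<forall>u<t. E u t \<longrightarrow> P u = P t \<longrightarrow> fit_level E P u \<noteq> fit_level E P t"
    unfolding fit_level_Least[of E P t] by (rule LeastI)
  then show ?thesis using assms by blast
qed

lemma fit_level_below: "l < fit_level E P t \<Longrightarrow> \<exists>u<t. E u t \<and> P u = P t \<and> fit_level E P u = l"
  unfolding fit_level_Least[of E P t] using not_less_Least by blast

text \<open>Two color classes with the same prediction are joined by an edge, so at most one of them is
  free of prediction errors.\<close>

lemma card_fit_color_le:
  fixes P f :: "nat \<Rightarrow> 'c"
  assumes "\<And>i j. i < n \<Longrightarrow> j < n \<Longrightarrow> E i j \<Longrightarrow> f i \<noteq> f j"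
  shows "card (fit_color E P ` {..<n}) \<le> card (f ` {..<n}) + card {t \<in> {..<n}. P t \<noteq> f t}"
proof -
  let ?S = "fit_color E P ` {..<n}" and ?B = "{t \<in> {..<n}. P t \<noteq> f t}"
  \<comment> \<open>The classes that contain a wrong prediction. Each of the others is determined by
    its prediction alone, which is a color of \<open>f\<close>.\<close>
  let ?S1 = "fit_color E P ` ?B"
  have correct: "P t = f t" if "fit_color E P t \<in> ?S - ?S1" "t < n" for t using that by blast
  have lt: "\<not> l < l'" if l: "(p, l) \<in> ?S - ?S1" "(p, l') \<in> ?S - ?S1" for p l l'
  proof
    assume "l < l'"
    from l(2) obtain t where t: "t < n" "(p, l') = fit_color E P t" by blast
    then have "l < fit_level E P t" using \<open>l < l'\<close> by (simp add: fit_color_def)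
    then obtain u where u: "u < t" "E u t" "P u = P t" "fit_level E P u = l" using fit_level_below by blast
    then have eq: "(p, l) = fit_color E P u" using t by (simp add: fit_color_def)
    have "P t = f t" by (rule correct) (use l(2) t in simp_all)
    moreover have "P u = f u" by (rule correct) (use l(1) eq u(1) t(1) in simp_all)
    ultimately show False using assms[of u t] u(1-3) t(1) by simp
  qed
  have "inj_on fst (?S - ?S1)"
  proof (rule inj_onI)
    fix x y assume xy: "x \<in> ?S - ?S1" "y \<in> ?S - ?S1" "fst x = fst y"
    obtain p l l' where eq: "x = (p, l)" "y = (p, l')" using xy(3) by (cases x; cases y) auto
    have "\<not> l < l'" "\<not> l' < l" using lt xy(1,2) unfolding eq by blast+
    then show "x = y" unfolding eq by simp
  qed
  moreover have "fst ` (?S - ?S1) \<subseteq> f ` {..<n}"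
  proof
    fix p assume "p \<in> fst ` (?S - ?S1)"
    then obtain t where t: "t < n" "fit_color E P t \<in> ?S - ?S1" "p = fst (fit_color E P t)" by blast
    then have "p = f t" using correct[OF t(2,1)] by (simp add: fit_color_def)
    then show "p \<in> f ` {..<n}" using t by blast
  qed
  ultimately have "card (?S - ?S1) \<le> card (f ` {..<n})" by (intro card_inj_on_le) auto
  moreover have "card ?S1 \<le> card ?B" by (intro card_image_le) auto
  moreover have "card ?S \<le> card (?S - ?S1) + card ?S1"
    using card_Un_le[of "?S - ?S1" ?S1] card_mono[of "(?S - ?S1) \<union> ?S1" ?S] by auto
  ultimately show ?thesis by linarith
qed

text \<open>First fit is used as long as it needs at most half as many colors as the bicoloring, or at most two
  colors, so that correct predictions are always followed.\<close>

definition use_fit :: "(nat \<Rightarrow> nat \<Rightarrow> bool) \<Rightarrow> (nat \<Rightarrow> 'c) \<Rightarrow> nat \<Rightarrow> bool" where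
  "use_fit E P t \<longleftrightarrow> 2 * card (fit_color E P ` {..t}) \<le> max 4 (card (bicolor E ` {..t}))"

definition combined ::
  "(('c \<times> nat) + (nat \<times> bool) \<Rightarrow> 'c) \<Rightarrow> (nat \<Rightarrow> nat \<Rightarrow> bool) \<Rightarrow> (nat \<Rightarrow> 'c) \<Rightarrow> nat \<Rightarrow> 'c" where
  "combined code E P t = code (if use_fit E P t then Inl (fit_color E P t) else Inr (bicolor E t))"

lemma combined_cong:
  assumes "\<And>i j. i \<le> t \<Longrightarrow> j \<le> t \<Longrightarrow> E i j = E' i j" "\<And>i. i \<le> t \<Longrightarrow> P i = P' i"
  shows "combined code E P t = combined code E' P' t"
proof -
  have f: "fit_color E P u = fit_color E' P' u" if "u \<le> t" for u
    using assms that unfolding fit_color_def by (auto intro!: fit_level_cong)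
  have b: "bicolor E u = bicolor E' u" if "u \<le> t" for u using assms that by (intro bicolor_cong) auto
  have "fit_color E P ` {..t} = fit_color E' P' ` {..t}" "bicolor E ` {..t} = bicolor E' ` {..t}"
    using f b by (auto intro!: image_cong)
  then show ?thesis unfolding combined_def use_fit_def using f b by simp
qed

text \<open>Both colorings are maintained for every vertex, whichever is output, so each is proper
  by itself; \<open>Inl\<close> and \<open>Inr\<close> keep the palettes apart.\<close>

lemma (in arrival_bipartition) combined_proper:
  assumes "inj code" "E t u" "u < t"
  shows "combined code E P t \<noteq> combined code E P u"
  using assms bicolor_proper[OF assms(2,3)] fit_level_proper[of E u t P] sym[OF assms(2)]
  unfolding combined_def fit_color_def by (auto simp: inj_eq)

text \<open>The counts only grow, so it suffices to look at the last vertex handled by each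
  coloring. At the last first fit vertex, at most max(4, r) / 2 fit colors had occurred; at the last
  bicolored one, fewer than 2 f bicolors had occurred, and f exceeds 2.\<close>

lemma card_combined:
  fixes P :: "nat \<Rightarrow> 'c" and E n code
  defines "f \<equiv> card (fit_color E P ` {..<n})" and "r \<equiv> card (bicolor E ` {..<n})"
    and "N \<equiv> card (combined code E P ` {..<n})"
  shows "f \<le> 2 \<Longrightarrow> N \<le> f" and "N \<le> 3 * f" and "2 * N \<le> max 4 r + 2 * r"
proof -
  let ?A = "{t. t < n \<and> use_fit E P t}" and ?B = "{t. t < n \<and> \<not> use_fit E P t}"
  have mono: "card (g ` {..t}) \<le> card (g ` {..<n})" if "t < n" for t and g :: "nat \<Rightarrow> 'x"
    using that by (intro card_mono) auto
  have "combined code E P ` {..<n} \<subseteq> (code \<circ> Inl) ` fit_color E P ` ?A \<union> (code \<circ> Inr) ` bicolor E ` ?B"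
    unfolding combined_def by auto
  then have "N \<le> card ((code \<circ> Inl) ` fit_color E P ` ?A \<union> (code \<circ> Inr) ` bicolor E ` ?B)"
    unfolding N_def by (intro card_mono) auto
  also have "\<dots> \<le> card ((code \<circ> Inl) ` fit_color E P ` ?A) + card ((code \<circ> Inr) ` bicolor E ` ?B)"
    by (rule card_Un_le)
  also have "\<dots> \<le> card (fit_color E P ` ?A) + card (bicolor E ` ?B)"
    by (intro add_mono card_image_le) auto
  finally have N: "N \<le> card (fit_color E P ` ?A) + card (bicolor E ` ?B)" .
  have A: "card (fit_color E P ` ?A) \<le> f" "2 * card (fit_color E P ` ?A) \<le> max 4 r"
  proof -
    show "card (fit_color E P ` ?A) \<le> f" unfolding f_def by (intro card_mono) auto
    show "2 * card (fit_color E P ` ?A) \<le> max 4 r"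
    proof (cases "?A = {}")
      case True
      show ?thesis unfolding True by simp
    next
      case False
      let ?t = "Max ?A"
      have t: "?t \<in> ?A" using False by (intro Max_in) auto
      have "?A \<subseteq> {..?t}" using Max_ge[of ?A] by auto
      then have "card (fit_color E P ` ?A) \<le> card (fit_color E P ` {..?t})" by (intro card_mono image_mono) auto
      then show ?thesis using t mono[of ?t "bicolor E"] unfolding use_fit_def r_def by auto
    qed
  qed
  have B: "card (bicolor E ` ?B) \<le> r" "card (bicolor E ` ?B) \<le> 2 * f" "f \<le> 2 \<Longrightarrow> card (bicolor E ` ?B) = 0"
  proof -
    show "card (bicolor E ` ?B) \<le> r" unfolding r_def by (intro card_mono) auto
    have *: "card (bicolor E ` ?B) \<le> 2 * f \<and> 2 < f" if "?B \<noteq> {}"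
    proof -
      let ?t = "Max ?B"
      have t: "?t \<in> ?B" using that by (intro Max_in) auto
      have "?B \<subseteq> {..?t}" using Max_ge[of ?B] by auto
      then have "card (bicolor E ` ?B) \<le> card (bicolor E ` {..?t})" by (intro card_mono image_mono) auto
      then show ?thesis using t mono[of ?t "fit_color E P"] unfolding use_fit_def f_def by auto
    qed
    have empty: "card (bicolor E ` ?B) = 0" if "?B = {}" unfolding that by simp
    show "card (bicolor E ` ?B) \<le> 2 * f" using * empty by linarith
    show "card (bicolor E ` ?B) = 0" if "f \<le> 2" using * empty that by linarith
  qed
  show "N \<le> f" if "f \<le> 2" using N A(1) B(3)[OF that] by linarith
  show "N \<le> 3 * f" using N A(1) B(2) by linarith
  show "2 * N \<le> max 4 r + 2 * r" using N A(2) B(1) by linarith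
qed

text \<open>The output colors come from the type of the predictions, which may be uncountable; the
  encoding rests on an infinite set being equipotent with its square.\<close>

lemma infinite_code:
  assumes "infinite (UNIV :: 'c set)"
  obtains code :: "('c \<times> nat) + (nat \<times> bool) \<Rightarrow> 'c" where "inj code"
proof -
  obtain g :: "nat \<Rightarrow> 'c" where g: "inj g" using infinite_countable_subset[OF assms] by blast
  obtain f :: "'c \<times> 'c \<Rightarrow> 'c" where f: "inj f"
    using card_of_ordLeq[THEN iffD2, OF ordIso_imp_ordLeq[OF card_of_Times_same_infinite[OF assms]]] by auto
  \<comment> \<open>The last component, \<open>g 0\<close> or \<open>g 1\<close>, separates the two
    palettes.\<close>
  define code where "code x = (case x of Inl (p, l) \<Rightarrow> f (f (p, g l), g 0) |
    Inr (i, c) \<Rightarrow> f (f (g i, g (if c then 1 else 0)), g 1))" for x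
  have "inj code"
    by (rule injI) (auto simp: code_def inj_eq[OF f] inj_eq[OF g] split: sum.splits prod.splits if_splits)
  then show ?thesis using that by blast
qed

section \<open>The combined algorithm\<close>

definition history_graph :: "(nat set \<times> 'p) list \<Rightarrow> nat \<Rightarrow> nat \<Rightarrow> bool" where
  "history_graph h i j \<longleftrightarrow> i < length h \<and> j < length h \<and>
     (i < j \<and> i \<in> fst (h ! j) \<or> j < i \<and> j \<in> fst (h ! i))"

definition combined_algorithm :: "(('c \<times> nat) + (nat \<times> bool) \<Rightarrow> 'c) \<Rightarrow> ('c, 'c) online_algorithm" where
  "combined_algorithm code h = combined code (history_graph h) (\<lambda>i. snd (h ! i)) (length h - 1)"

lemma finite_graph_edge:
  assumes "finite_graph G" "{u, v} \<in> edges G"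
  shows "u \<noteq> v" "u \<in> verts G" "v \<in> verts G"
  using assms unfolding finite_graph_def by fastforce+

text \<open>The history at time \<open>t\<close> determines the arrival graph and the predictions up
  to \<open>t\<close>, and by \<open>combined_cong\<close> nothing else influences the color of
  \<open>t\<close>.\<close>

lemma online_coloring_combined:
  assumes G: "finite_graph G" and \<pi>: "\<pi> \<in> permutations_of_set (verts G)" and t: "t < length \<pi>"
  shows "online_coloring (combined_algorithm code) G \<pi> P (\<pi> ! t)
    = combined code (arrival_graph G \<pi>) (\<lambda>i. P (\<pi> ! i)) t"
proof -
  have d: "distinct \<pi>" using \<pi> by (auto simp: permutations_of_set_def)
  let ?h = "history G P (take (Suc t) \<pi>)"
  have len: "length ?h = Suc t" using t by (simp add: history_def)
  have nth: "?h ! i = ({j. j < i \<and> {\<pi> ! j, \<pi> ! i} \<in> edges G}, P (\<pi> ! i))" if "i \<le> t" for i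
    using that t by (auto simp: history_def simp del: upt_Suc)
  have hg: "history_graph ?h i j = arrival_graph G \<pi> i j" if "i \<le> t" "j \<le> t" for i j
  proof -
    have "i < length \<pi>" "j < length \<pi>" using that t by auto
    moreover have "i \<noteq> j" if "{\<pi> ! i, \<pi> ! j} \<in> edges G" using finite_graph_edge(1)[OF G that] by auto
    ultimately show ?thesis
      using that nth unfolding history_graph_def arrival_graph_def len by (auto simp: insert_commute neq_iff)
  qed
  have "combined code (history_graph ?h) (\<lambda>i. snd (?h ! i)) t
      = combined code (arrival_graph G \<pi>) (\<lambda>i. P (\<pi> ! i)) t"
    by (rule combined_cong) (simp_all add: hg nth)
  then show ?thesis unfolding online_coloring_nth[OF d t] combined_algorithm_def len by simp
qed

section \<open>Chromatic numbers and prediction error\<close>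

lemma bipartite_side:
  assumes "G \<in> bipartite_graphs" "\<pi> \<in> permutations_of_set (verts G)"
  obtains s where "arrival_bipartition (arrival_graph G \<pi>) s"
proof -
  obtain S T where ST: "S \<inter> T = {}" "\<forall>e\<in>edges G. \<exists>s\<in>S. \<exists>t\<in>T. e = {s, t}"
    using assms(1) unfolding bipartite_graphs_def bipartite_def by blast
  have "(\<pi> ! i \<in> S) \<noteq> (\<pi> ! j \<in> S)" if "arrival_graph G \<pi> i j" for i j
  proof -
    obtain a b where "a \<in> S" "b \<in> T" "{\<pi> ! i, \<pi> ! j} = {a, b}"
      using ST(2) \<open>arrival_graph G \<pi> i j\<close> unfolding arrival_graph_def by blast
    then show ?thesis using ST(1) by (auto simp: doubleton_eq_iff)
  qed
  then have "arrival_bipartition (arrival_graph G \<pi>) (\<lambda>i. \<pi> ! i \<in> S)"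
    by unfold_locales (auto intro: arrival_graph_sym)
  then show ?thesis using that by blast
qed

lemma chromatic_number_attained:
  fixes G :: "'v graph"
  assumes "finite_graph G"
  obtains f :: "'v \<Rightarrow> nat" where "proper_coloring G f" "num_colors G f = chromatic_number G"
proof -
  have "finite (verts G)" using assms by (simp add: finite_graph_def)
  then obtain g :: "'v \<Rightarrow> nat" where g: "inj_on g (verts G)" using finite_imp_inj_to_nat_seg by blast
  then have "proper_coloring G g"
    unfolding proper_coloring_def using finite_graph_edge[OF assms] by (meson inj_onD)
  then have "\<exists>k. \<exists>f :: 'v \<Rightarrow> nat. proper_coloring G f \<and> num_colors G f = k" by blast
  then have "\<exists>f :: 'v \<Rightarrow> nat. proper_coloring G f \<and> num_colors G f = chromatic_number G"
    unfolding chromatic_number_def by (rule LeastI_ex)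
  then show ?thesis using that by blast
qed

text \<open>The definition uses natural numbers as colors; other colorings are transported by an
  injection of their finite palette.\<close>

lemma chromatic_number_le:
  fixes f :: "'v \<Rightarrow> 'c"
  assumes "finite_graph G" "proper_coloring G f"
  shows "chromatic_number G \<le> num_colors G f"
proof -
  have fin: "finite (f ` verts G)" using assms(1) by (simp add: finite_graph_def)
  then obtain g :: "'c \<Rightarrow> nat" where g: "inj_on g (f ` verts G)" using finite_imp_inj_to_nat_seg by blast
  have "proper_coloring G (g \<circ> f)"
    unfolding proper_coloring_def
  proof (intro allI impI)
    fix u v assume e: "{u, v} \<in> edges G"
    then have "f u \<noteq> f v" using assms(2) unfolding proper_coloring_def by blast
    then show "(g \<circ> f) u \<noteq> (g \<circ> f) v"
      using finite_graph_edge[OF assms(1) e] g by (auto simp: inj_on_def)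
  qed
  moreover have "num_colors G (g \<circ> f) = num_colors G f"
    unfolding num_colors_def using card_image[OF g] by (simp add: image_comp)
  ultimately show ?thesis unfolding chromatic_number_def by (intro Least_le) auto
qed

lemma chromatic_number_le_online:
  fixes G :: "'v graph"
  assumes "finite_graph G"
  shows "chromatic_number G \<le> online_chromatic_number G"
proof -
  obtain A where A: "online_coloring_algorithm {H :: 'v graph. finite_graph H} A"
    "algorithm_chromatic_number A G = online_chromatic_number G" by (rule online_chromatic_number_attained)
  have fin: "finite (verts G)" using assms by (simp add: finite_graph_def)
  obtain \<pi> where \<pi>: "\<pi> \<in> permutations_of_set (verts G)" using permutation_extending[OF fin, of "[]"] by auto
  let ?f = "online_coloring A G \<pi> (\<lambda>_. ())"
  have "proper_coloring G ?f" using A(1) assms \<pi> unfolding online_coloring_algorithm_def by blast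
  then have "chromatic_number G \<le> num_colors G ?f" by (rule chromatic_number_le[OF assms])
  also have "\<dots> \<le> algorithm_chromatic_number A G"
    unfolding algorithm_chromatic_number_def using \<pi> fin by (intro Max_ge) auto
  finally show ?thesis using A(2) by simp
qed

lemma chromatic_number_edgeless:
  assumes "finite_graph G" "edges G = {}"
  shows "chromatic_number G = 1"
proof (rule antisym)
  have "proper_coloring G (\<lambda>_. 0 :: nat)" using assms(2) by (simp add: proper_coloring_def)
  moreover have "(\<lambda>_. 0 :: nat) ` verts G = {0}" using assms(1) by (auto simp: finite_graph_def)
  ultimately show "chromatic_number G \<le> 1"
    using chromatic_number_le[OF assms(1), of "\<lambda>_. 0 :: nat"] by (simp add: num_colors_def)
  obtain f :: "_ \<Rightarrow> nat" where "num_colors G f = chromatic_number G" using chromatic_number_attained[OF assms(1)] .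
  moreover have "0 < card (f ` verts G)" using assms(1) by (auto simp: finite_graph_def card_gt_0_iff)
  ultimately show "1 \<le> chromatic_number G" by (simp add: num_colors_def)
qed

lemma chromatic_number_bipartite:
  assumes "G \<in> bipartite_graphs" "edges G \<noteq> {}"
  shows "chromatic_number G = 2"
proof (rule antisym)
  have G: "finite_graph G" using assms(1) by (simp add: bipartite_graphs_def)
  obtain S T where ST: "S \<inter> T = {}" "\<forall>e\<in>edges G. \<exists>s\<in>S. \<exists>t\<in>T. e = {s, t}"
    using assms(1) unfolding bipartite_graphs_def bipartite_def by blast
  let ?f = "\<lambda>v. v \<in> S"
  have "proper_coloring G ?f"
    unfolding proper_coloring_def
  proof (intro allI impI)
    fix u v assume "{u, v} \<in> edges G"
    then obtain a b where "a \<in> S" "b \<in> T" "{u, v} = {a, b}" using ST(2) by blast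
    then show "?f u \<noteq> ?f v" using ST(1) by (auto simp: doubleton_eq_iff)
  qed
  from chromatic_number_le[OF G this] have "chromatic_number G \<le> card (?f ` verts G)" by (simp add: num_colors_def)
  also have "\<dots> \<le> card (UNIV :: bool set)" by (intro card_mono) auto
  finally show "chromatic_number G \<le> 2" by simp
  obtain f :: "_ \<Rightarrow> nat" where f: "proper_coloring G f" "num_colors G f = chromatic_number G"
    using chromatic_number_attained[OF G] .
  obtain e' where e': "e' \<in> edges G" using assms(2) by blast
  then obtain u v where "e' = {u, v}" using ST(2) by fast
  with e' have e: "{u, v} \<in> edges G" by simp
  then have "f u \<noteq> f v" "{f u, f v} \<subseteq> f ` verts G"
    using f(1) finite_graph_edge[OF G e] unfolding proper_coloring_def by auto
  then have "2 \<le> card (f ` verts G)"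
    using card_mono[of "f ` verts G" "{f u, f v}"] G by (auto simp: finite_graph_def)
  then show "2 \<le> chromatic_number G" using f(2) by (simp add: num_colors_def)
qed

text \<open>An infinite palette guarantees that a coloring with exactly
  \<open>chromatic_number G\<close> colors exists, so the \<open>LEAST\<close> is
  meaningful.\<close>

lemma prediction_error_attained:
  fixes P :: "'v \<Rightarrow> 'c"
  assumes "finite_graph G" "infinite (UNIV :: 'c set)"
  obtains f :: "'v \<Rightarrow> 'c" where "proper_coloring G f" "num_colors G f = chromatic_number G"
    "card {v \<in> verts G. P v \<noteq> f v} = prediction_error G P"
proof -
  obtain f :: "'v \<Rightarrow> nat" where f: "proper_coloring G f" "num_colors G f = chromatic_number G"
    using chromatic_number_attained[OF assms(1)] .
  obtain g :: "nat \<Rightarrow> 'c" where g: "inj g" using infinite_countable_subset[OF assms(2)] by blast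
  have "proper_coloring G (g \<circ> f)" using f(1) g by (auto simp: proper_coloring_def inj_eq)
  moreover have "card (g ` f ` verts G) = card (f ` verts G)"
    using g by (intro card_image) (auto intro: inj_on_subset)
  then have "num_colors G (g \<circ> f) = chromatic_number G" using f(2) by (simp add: num_colors_def image_comp)
  ultimately have "\<exists>m. \<exists>f :: 'v \<Rightarrow> 'c. proper_coloring G f \<and> num_colors G f = chromatic_number G \<and>
        card {v \<in> verts G. P v \<noteq> f v} = m" by blast
  then have "\<exists>f :: 'v \<Rightarrow> 'c. proper_coloring G f \<and> num_colors G f = chromatic_number G \<and>
        card {v \<in> verts G. P v \<noteq> f v} = prediction_error G P"
    unfolding prediction_error_def by (rule LeastI_ex)
  then show ?thesis using that by blast
qed

lemma combined_algorithm_proper: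
  fixes code :: "('c \<times> nat) + (nat \<times> bool) \<Rightarrow> 'c"
  assumes "inj code" and G: "G \<in> bipartite_graphs" and \<pi>: "\<pi> \<in> permutations_of_set (verts G)"
  shows "proper_coloring G (online_coloring (combined_algorithm code) G \<pi> P)"
  unfolding proper_coloring_def
proof (intro allI impI)
  fix u v assume e: "{u, v} \<in> edges G"
  have G': "finite_graph G" using G by (simp add: bipartite_graphs_def)
  obtain s where "arrival_bipartition (arrival_graph G \<pi>) s" using bipartite_side[OF G \<pi>] .
  then interpret arrival_bipartition "arrival_graph G \<pi>" s .
  have "u \<in> set \<pi>" "v \<in> set \<pi>" "u \<noteq> v"
    using finite_graph_edge[OF G' e] \<pi> by (auto simp: permutations_of_set_def)
  then obtain i j where ij: "i < length \<pi>" "j < length \<pi>" "u = \<pi> ! i" "v = \<pi> ! j" "i \<noteq> j"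
    by (metis in_set_conv_nth)
  have "arrival_graph G \<pi> i j" "arrival_graph G \<pi> j i"
    using ij e by (auto simp: arrival_graph_def insert_commute)
  then have "combined code (arrival_graph G \<pi>) (\<lambda>i. P (\<pi> ! i)) i \<noteq> combined code (arrival_graph G \<pi>) (\<lambda>i. P (\<pi> ! i)) j"
    using combined_proper[OF assms(1)] ij(5) by (metis linorder_neqE_nat)
  then show "online_coloring (combined_algorithm code) G \<pi> P u \<noteq> online_coloring (combined_algorithm code) G \<pi> P v"
    using ij by (simp add: online_coloring_combined[OF G' \<pi>])
qed

text \<open>Reduces every part of the result to a bound of \<open>4 * X\<close> on the bicoloring
  alone.\<close>

lemma combined_algorithm_ratio:
  fixes code :: "('c \<times> nat) + (nat \<times> bool) \<Rightarrow> 'c" and P :: "'v \<Rightarrow> 'c"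
  assumes inf: "infinite (UNIV :: 'c set)" and code: "inj code"
    and G: "G \<in> bipartite_graphs" and \<pi>: "\<pi> \<in> permutations_of_set (verts G)"
    and X: "1 \<le> X" "edges G \<noteq> {} \<Longrightarrow> real (card (bicolor (arrival_graph G \<pi>) ` {..<length \<pi>})) \<le> 4 * X"
  shows "prediction_error G P = 0 \<Longrightarrow> color_ratio (combined_algorithm code) G \<pi> P = 1"
    and "prediction_error G P \<noteq> 0 \<Longrightarrow>
      color_ratio (combined_algorithm code) G \<pi> P \<le> 3 * min (real (prediction_error G P) / 2 + 1) X"
proof -
  have G': "finite_graph G" using G by (simp add: bipartite_graphs_def)
  have d: "distinct \<pi>" "set \<pi> = verts G" using \<pi> by (auto simp: permutations_of_set_def)
  let ?n = "length \<pi>" and ?E = "arrival_graph G \<pi>" and ?P = "\<lambda>i. P (\<pi> ! i)"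
  let ?A = "combined_algorithm code"
  define f where "f = card (fit_color ?E ?P ` {..<?n})"
  define r where "r = card (bicolor ?E ` {..<?n})"
  define N where "N = card (combined code ?E ?P ` {..<?n})"
  define \<chi> where "\<chi> = chromatic_number G"
  define \<eta> where "\<eta> = prediction_error G P"
  have verts: "verts G = (!) \<pi> ` {..<?n}" using d(2) by (auto simp: set_conv_nth)
  have "online_coloring ?A G \<pi> P ` verts G = combined code ?E ?P ` {..<?n}"
    unfolding verts image_image by (intro image_cong) (simp_all add: online_coloring_combined[OF G' \<pi>])
  then have N: "num_colors G (online_coloring ?A G \<pi> P) = N" by (simp add: num_colors_def N_def)
  have \<chi>N: "\<chi> \<le> N"
    unfolding \<chi>_def N[symmetric] by (intro chromatic_number_le combined_algorithm_proper G' G \<pi> code)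
  obtain h :: "'v \<Rightarrow> 'c" where h: "proper_coloring G h" "num_colors G h = \<chi>" "card {v \<in> verts G. P v \<noteq> h v} = \<eta>"
    unfolding \<chi>_def \<eta>_def using prediction_error_attained[OF G' inf] .
  have inj: "inj_on ((!) \<pi>) A" if "A \<subseteq> {..<?n}" for A
    using d(1) that by (auto simp: inj_on_def nth_eq_iff_index_eq subset_iff)
  have "{v \<in> verts G. P v \<noteq> h v} = (!) \<pi> ` {t \<in> {..<?n}. ?P t \<noteq> h (\<pi> ! t)}" unfolding verts by auto
  then have "card {t \<in> {..<?n}. ?P t \<noteq> h (\<pi> ! t)} = \<eta>"
    using h(3) card_image[OF inj[of "{t \<in> {..<?n}. ?P t \<noteq> h (\<pi> ! t)}"]] by (simp add: subset_iff)
  moreover have "card ((\<lambda>t. h (\<pi> ! t)) ` {..<?n}) = \<chi>"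
    using h(2) unfolding num_colors_def verts image_image .
  moreover have "h (\<pi> ! i) \<noteq> h (\<pi> ! j)" if "?E i j" for i j
    using h(1) that unfolding proper_coloring_def arrival_graph_def by blast
  ultimately have f: "f \<le> \<chi> + \<eta>"
    unfolding f_def using card_fit_color_le[of ?n ?E "\<lambda>t. h (\<pi> ! t)" ?P] by simp
  note C = card_combined[where E = ?E and P = ?P and n = ?n and code = code, folded f_def r_def N_def]
  have \<chi>12: "\<chi> = (if edges G = {} then 1 else 2)"
    using chromatic_number_edgeless[OF G'] chromatic_number_bipartite[OF G] unfolding \<chi>_def by auto
  have ratio: "color_ratio ?A G \<pi> P = real N / real \<chi>" unfolding color_ratio_def N \<chi>_def ..
  show "color_ratio ?A G \<pi> P = 1" if "prediction_error G P = 0"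
  proof -
    \<comment> \<open>Correct predictions give at most two fit colors, so the algorithm never leaves
      first fit.\<close>
    have "f \<le> \<chi>" using f that by (simp add: \<eta>_def)
    then have "N \<le> f" using C(1) \<chi>12 by (auto split: if_splits)
    then have "N = \<chi>" using \<open>f \<le> \<chi>\<close> \<chi>N by simp
    then show ?thesis using \<chi>12 unfolding ratio by auto
  qed
  show "color_ratio ?A G \<pi> P \<le> 3 * min (real (prediction_error G P) / 2 + 1) X" if "prediction_error G P \<noteq> 0"
  proof (cases "edges G = {}")
    case True
    obtain s where "arrival_bipartition ?E s" using bipartite_side[OF G \<pi>] .
    then interpret arrival_bipartition ?E s .
    have "bicolor ?E t = (0, True)" for t by (rule bicolor_isolated) (simp add: arrival_graph_def True)
    then have "bicolor ?E ` {..<?n} \<subseteq> {(0, True)}" by auto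
    then have "r \<le> 1" unfolding r_def using card_mono[of "{(0 :: nat, True)}"] by fastforce
    \<comment> \<open>From 2 N <= 4 + 2. This suffices because both terms of the minimum are at
      least 1.\<close>
    then have "N \<le> 3" using C(3) by auto
    then show ?thesis using True X(1) unfolding ratio \<chi>12 by (auto simp: min_def)
  next
    case False
    have "real N \<le> 3 * real f" using C(2) by linarith
    also have "\<dots> \<le> 3 * (2 + real \<eta>)" using f \<chi>12 False by simp
    finally have 1: "real N / 2 \<le> 3 * (real \<eta> / 2 + 1)" by simp
    have "real (2 * N) \<le> real (max 4 r + 2 * r)" using C(3) by (rule of_nat_mono)
    then have "2 * real N \<le> max 4 (real r) + 2 * real r" by (simp add: of_nat_max)
    \<comment> \<open>With \<open>1 \<le> X\<close> also max(4, r) is at most 4 X, so 2 N is at most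
      12 X.\<close>
    moreover have "real r \<le> 4 * X" using X(2)[OF False] by (simp add: r_def)
    ultimately have "real N / 2 \<le> 3 * X" using X(1) by (auto simp: max_def split: if_splits)
    then show ?thesis using 1 False unfolding ratio \<chi>12 \<eta>_def by (simp add: min_def)
  qed
qed

section \<open>Bounds on the bicoloring for the five classes\<close>

lemma path_free_arrival:
  assumes G: "G \<in> bipartite_graphs" and \<pi>: "\<pi> \<in> permutations_of_set (verts G)" and q: "path_free q G" "2 \<le> q"
    and s: "arrival_bipartition (arrival_graph G \<pi>) s"
  shows "\<nexists>p. ipath (arrival_graph G \<pi>) p \<and> length p = q"
proof
  assume "\<exists>p. ipath (arrival_graph G \<pi>) p \<and> length p = q"
  then obtain p where p: "ipath (arrival_graph G \<pi>) p" "length p = q" by blast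
  interpret arrival_bipartition "arrival_graph G \<pi>" s by fact
  have d: "distinct \<pi>" "set \<pi> = verts G" using \<pi> by (auto simp: permutations_of_set_def)
  have lt: "p ! i < length \<pi>" if "i < length p" for i
  proof -
    \<comment> \<open>A path on at least two vertices gives each vertex a neighbor, and only arrival
      positions have neighbors; a single vertex could be any number.\<close>
    have "\<exists>j<length p. i = Suc j \<or> j = Suc i"
      using that p(2) q(2) by (cases i) (auto intro: exI[of _ 1] exI[of _ "i - 1"])
    then show ?thesis using ipath_nth[OF p(1) that] unfolding arrival_graph_def by blast
  qed
  have "induced_path G (map ((!) \<pi>) p)"
    unfolding induced_path_def
  proof (intro conjI allI impI)
    have "x < length \<pi>" if "x \<in> set p" for x using that lt by (auto simp: in_set_conv_nth)
    then show "distinct (map ((!) \<pi>) p)" "set (map ((!) \<pi>) p) \<subseteq> verts G"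
      using ipath_distinct[OF p(1)] d by (auto simp: distinct_map inj_on_def nth_eq_iff_index_eq)
    fix i j assume "i < length (map ((!) \<pi>) p)" "j < length (map ((!) \<pi>) p)"
    then show "{map ((!) \<pi>) p ! i, map ((!) \<pi>) p ! j} \<in> edges G \<longleftrightarrow> i = Suc j \<or> j = Suc i"
      using ipath_nth[OF p(1), of i j] lt[of i] lt[of j] unfolding arrival_graph_def by simp
  qed
  then show False using q(1) p(2) unfolding path_free_def by (metis length_map)
qed

text \<open>An index of \<open>L\<close> or more would come with a node of level \<open>L\<close>
  among the arrival positions, where more colors would be forced than the online chromatic number
  allows.\<close>

lemma card_bicolor_competitive:
  assumes G: "G \<in> bipartite_graphs" and \<pi>: "\<pi> \<in> permutations_of_set (verts G)"
    and s: "arrival_bipartition (arrival_graph G \<pi>) s"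
    and L: "level_forces (arrival_graph G \<pi>) s L (Suc (online_chromatic_number G))"
  shows "card (bicolor (arrival_graph G \<pi>) ` {..<length \<pi>}) \<le> 2 * L"
proof -
  interpret arrival_bipartition "arrival_graph G \<pi>" s by fact
  let ?E = "arrival_graph G \<pi>"
  show ?thesis
  proof (rule card_bicolor_le, rule ccontr)
    fix t assume t: "t < length \<pi>" "\<not> idx ?E t < L"
    obtain T b where T: "T \<subseteq> component ?E t" "node ?E s (idx ?E t) b T" using bicolor_node by blast
    then obtain T' where T': "T' \<subseteq> T" "node ?E s L b T'" using node_le[OF T(2), of L] t(2) by auto
    then obtain c where c: "forcing ?E s (Suc (online_chromatic_number G)) c T'"
      using L unfolding level_forces_def by blast
    have "T' \<subseteq> {..<length \<pi>}" using T(1) T'(1) component_le[of _ ?E t] t(1) by fastforce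
    moreover have "finite_graph G" using G by (simp add: bipartite_graphs_def)
    ultimately have "Suc (online_chromatic_number G) \<le> online_chromatic_number G"
      using online_chromatic_number_ge[OF _ \<pi> bip c] by blast
    then show False by simp
  qed
qed

lemma online_chromatic_number_pos:
  assumes "G \<in> bipartite_graphs"
  shows "1 \<le> online_chromatic_number G" "edges G \<noteq> {} \<Longrightarrow> 2 \<le> online_chromatic_number G"
proof -
  have G: "finite_graph G" using assms by (simp add: bipartite_graphs_def)
  show "1 \<le> online_chromatic_number G" "edges G \<noteq> {} \<Longrightarrow> 2 \<le> online_chromatic_number G"
    using chromatic_number_le_online[OF G] chromatic_number_edgeless[OF G] chromatic_number_bipartite[OF assms]
    by (cases "edges G = {}"; simp)+
qed

text \<open>With online chromatic number \<open>Suc k\<close> there are at most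
  \<open>2 * k + 1\<close> indices, and doubling gives exactly the bound.\<close>

lemma card_bicolor_P6_free:
  assumes "G \<in> bipartite_graphs" "path_free 6 G" "\<pi> \<in> permutations_of_set (verts G)"
  shows "real (card (bicolor (arrival_graph G \<pi>) ` {..<length \<pi>})) \<le> 4 * (real (online_chromatic_number G) - 1 / 2)"
proof -
  obtain s where s: "arrival_bipartition (arrival_graph G \<pi>) s" using bipartite_side[OF assms(1,3)] .
  then interpret arrival_bipartition "arrival_graph G \<pi>" s .
  obtain k where k: "online_chromatic_number G = Suc k"
    using online_chromatic_number_pos(1)[OF assms(1)] by (cases "online_chromatic_number G") auto
  have "card (bicolor (arrival_graph G \<pi>) ` {..<length \<pi>}) \<le> 2 * (2 * k + 1)"
    using P6_free_levels[OF path_free_arrival[OF assms(1,3,2) _ s], of k] k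
    by (intro card_bicolor_competitive[OF assms(1,3) s]) simp
  then show ?thesis unfolding k by simp
qed

lemma card_bicolor_P7_free:
  assumes "G \<in> bipartite_graphs" "path_free 7 G" "\<pi> \<in> permutations_of_set (verts G)"
  shows "real (card (bicolor (arrival_graph G \<pi>) ` {..<length \<pi>})) \<le> 4 * (2 * real (online_chromatic_number G) - 1 / 2)"
proof -
  obtain s where s: "arrival_bipartition (arrival_graph G \<pi>) s" using bipartite_side[OF assms(1,3)] .
  then interpret arrival_bipartition "arrival_graph G \<pi>" s .
  obtain k where k: "online_chromatic_number G = Suc k"
    using online_chromatic_number_pos(1)[OF assms(1)] by (cases "online_chromatic_number G") auto
  have "card (bicolor (arrival_graph G \<pi>) ` {..<length \<pi>}) \<le> 2 * (3 * k + 1)"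
    using P7_free_levels[OF path_free_arrival[OF assms(1,3,2) _ s], of k] k
    by (intro card_bicolor_competitive[OF assms(1,3) s]) simp
  then show ?thesis unfolding k by simp
qed

text \<open>The constant 6 is four times the 3/2 of the eight vertex case, so the lemma serves eight
  and nine vertices alike.\<close>

lemma card_bicolor_P9_free:
  assumes "G \<in> bipartite_graphs" "path_free q G" "2 \<le> q" "q \<le> 9" "\<pi> \<in> permutations_of_set (verts G)"
  shows "real (card (bicolor (arrival_graph G \<pi>) ` {..<length \<pi>})) \<le> 6 * (real (online_chromatic_number G) + 1) ^ 2"
proof -
  obtain s where s: "arrival_bipartition (arrival_graph G \<pi>) s" using bipartite_side[OF assms(1,5)] .
  then interpret arrival_bipartition "arrival_graph G \<pi>" s .
  let ?k = "online_chromatic_number G"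
  have "\<nexists>p. ipath (arrival_graph G \<pi>) p \<and> length p = 9"
    by (rule no_longer_ipath[OF path_free_arrival[OF assms(1,5,2,3) s] assms(4)])
  then have "card (bicolor (arrival_graph G \<pi>) ` {..<length \<pi>}) \<le> 2 * (?k ^ 2 + 4 * ?k)"
    by (intro card_bicolor_competitive[OF assms(1,5) s] P9_free_levels)
  also have "\<dots> \<le> 6 * (?k + 1) ^ 2" by (simp add: power2_eq_square)
  finally have "real (card (bicolor (arrival_graph G \<pi>) ` {..<length \<pi>})) \<le> real (6 * (?k + 1) ^ 2)"
    by (rule of_nat_mono)
  then show ?thesis by (simp add: add.commute)
qed

lemma card_bicolor_log:
  assumes "G \<in> bipartite_graphs" "\<pi> \<in> permutations_of_set (verts G)"
  shows "real (card (bicolor (arrival_graph G \<pi>) ` {..<length \<pi>})) \<le> 4 * (1 + log 2 (real (card (verts G))))"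
proof -
  obtain s where s: "arrival_bipartition (arrival_graph G \<pi>) s" using bipartite_side[OF assms] .
  then interpret arrival_bipartition "arrival_graph G \<pi>" s .
  let ?E = "arrival_graph G \<pi>" and ?n = "card (verts G)"
  have n: "length \<pi> = ?n" using assms(2) distinct_card[of \<pi>] by (auto simp: permutations_of_set_def)
  have n1: "1 \<le> ?n" using assms(1) by (auto simp: bipartite_graphs_def finite_graph_def Suc_le_eq card_gt_0_iff)
  \<comment> \<open>A node of level \<open>i\<close> has at least \<open>2 ^ i\<close> vertices, so
    no index exceeds \<open>L\<close>.\<close>
  define L where "L = nat \<lfloor>log 2 (real ?n)\<rfloor>"
  have log0: "0 \<le> log 2 (real ?n)" using n1 by simp
  have "idx ?E t < Suc L" if "t < length \<pi>" for t
  proof -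
    obtain T where T: "T \<subseteq> component ?E t" "node ?E s (idx ?E t) (vote ?E s t) T" using bicolor_node by blast
    have "component ?E t \<subseteq> {..<length \<pi>}" using component_le[of _ ?E t] that by fastforce
    then have "T \<subseteq> {..<length \<pi>}" using T(1) by blast
    then have "finite T" "card T \<le> ?n" using finite_subset card_mono[of "{..<length \<pi>}" T] n by auto
    then have "2 ^ idx ?E t \<le> ?n" using node_card[OF T(2)] by linarith
    then have "real (2 ^ idx ?E t) \<le> real ?n" by (rule of_nat_mono)
    then have "real (idx ?E t) \<le> log 2 (real ?n)" using n1 by (simp add: le_log_iff powr_realpow)
    then show ?thesis unfolding L_def by linarith
  qed
  then have "card (bicolor ?E ` {..<length \<pi>}) \<le> 2 * Suc L" by (rule card_bicolor_le)
  then have "real (card (bicolor ?E ` {..<length \<pi>})) \<le> real (2 * Suc L)" by (rule of_nat_mono)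
  moreover have "real L \<le> log 2 (real ?n)" unfolding L_def using log0 by linarith
  ultimately show ?thesis using log0 by simp
qed

theorem theorem5:
  assumes "infinite (UNIV :: 'c set)"
  shows
    "(\<exists>X :: nat \<Rightarrow> real. X \<in> \<Theta>(\<lambda>n. ln (real n)) \<and>
       (\<exists>A :: ('c, 'c) online_algorithm.
          online_coloring_algorithm (bipartite_graphs :: 'v graph set) A \<and>
          ratio_guarantee (bipartite_graphs :: 'v graph set) (\<lambda>G. X (card (verts G))) A)) \<and>
     (\<exists>A :: ('c, 'c) online_algorithm.
        online_coloring_algorithm (path_free_bipartite_graphs 6 :: 'v graph set) A \<and>
        ratio_guarantee (path_free_bipartite_graphs 6 :: 'v graph set) P6_free_value A) \<and>
     (\<exists>A :: ('c, 'c) online_algorithm.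
        online_coloring_algorithm (path_free_bipartite_graphs 7 :: 'v graph set) A \<and>
        ratio_guarantee (path_free_bipartite_graphs 7 :: 'v graph set)
          (\<lambda>G. 2 * real (online_chromatic_number G) - 1 / 2) A) \<and>
     (\<exists>A :: ('c, 'c) online_algorithm.
        online_coloring_algorithm (path_free_bipartite_graphs 8 :: 'v graph set) A \<and>
        ratio_guarantee (path_free_bipartite_graphs 8 :: 'v graph set)
          (\<lambda>G. 3 * (real (online_chromatic_number G) + 1)\<^sup>2 / 2) A) \<and>
     (\<exists>A :: ('c, 'c) online_algorithm.
        online_coloring_algorithm (path_free_bipartite_graphs 9 :: 'v graph set) A \<and>
        ratio_guarantee (path_free_bipartite_graphs 9 :: 'v graph set)
          (\<lambda>G. 3 * (real (online_chromatic_number G) + 1)\<^sup>2) A)"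
proof -
  obtain code :: "('c \<times> nat) + (nat \<times> bool) \<Rightarrow> 'c" where code: "inj code" using infinite_code[OF assms] .
  let ?A = "combined_algorithm code"
  \<comment> \<open>One and the same algorithm serves all five classes; only the bound on the
    bicoloring differs.\<close>
  have main: "online_coloring_algorithm C ?A \<and> ratio_guarantee C X ?A"
    if C: "C \<subseteq> bipartite_graphs" and X1: "\<And>G. G \<in> C \<Longrightarrow> 1 \<le> X G"
      and X4: "\<And>G \<pi>. G \<in> C \<Longrightarrow> edges G \<noteq> {} \<Longrightarrow> \<pi> \<in> permutations_of_set (verts G) \<Longrightarrow>
        real (card (bicolor (arrival_graph G \<pi>) ` {..<length \<pi>})) \<le> 4 * X G"
    for C :: "'v graph set" and X
  proof
    show "online_coloring_algorithm C ?A"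
      unfolding online_coloring_algorithm_def using C combined_algorithm_proper[OF code] by blast
    show "ratio_guarantee C X ?A"
      unfolding ratio_guarantee_def
    proof (intro ballI allI conjI impI)
      fix G \<pi> and P :: "'v \<Rightarrow> 'c" assume G: "G \<in> C" "\<pi> \<in> permutations_of_set (verts G)"
      then have "G \<in> bipartite_graphs" using C by blast
      note R = combined_algorithm_ratio[OF assms code this G(2) X1[OF G(1)] X4[OF G(1) _ G(2)], where P = P]
      show "color_ratio ?A G \<pi> P = 1" if "prediction_error G P = 0" using R(1) that by blast
      show "color_ratio ?A G \<pi> P \<le> 3 * min (real (prediction_error G P) / 2 + 1) (X G)"
        if "prediction_error G P \<noteq> 0" using R(2) that by blast
    qed
  qed
  have sub: "path_free_bipartite_graphs q \<subseteq> (bipartite_graphs :: 'v graph set)" for q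
    unfolding path_free_bipartite_graphs_def by auto
  have pf: "G \<in> bipartite_graphs" "path_free q G" "1 \<le> online_chromatic_number G"
      "edges G \<noteq> {} \<Longrightarrow> 2 \<le> online_chromatic_number G"
    if "G \<in> path_free_bipartite_graphs q" for q and G :: "'v graph"
    using that online_chromatic_number_pos[of G] unfolding path_free_bipartite_graphs_def by auto
  have sq: "4 \<le> (real (online_chromatic_number G) + 1)\<^sup>2" if "G \<in> path_free_bipartite_graphs q" for q and G :: "'v graph"
    using pf(3)[OF that] power_mono[of 2 "real (online_chromatic_number G) + 1" 2] by simp
  let ?X = "\<lambda>n. 1 + log 2 (real n)"
  \<comment> \<open>From \<open>n = 3\<close> on, \<open>ln (real n)\<close> is at least 1 and
    absorbs the additive 1 of \<open>?X\<close>; the lower bound uses that \<open>ln 2\<close> is at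
    most 1.\<close>
  have 1: "?X \<in> \<Theta>(\<lambda>n. ln (real n))"
  proof (rule bigthetaI'[of 1 "1 + 1 / ln 2"])
    show "\<forall>\<^sub>F n in sequentially. 1 * norm (ln (real n)) \<le> norm (?X n) \<and> norm (?X n) \<le> (1 + 1 / ln 2) * norm (ln (real n))"
      using eventually_ge_at_top[of 3]
    proof (rule eventually_mono)
      fix n :: nat assume n: "3 \<le> n"
      have "exp 1 \<le> real n" using n exp_le by linarith
      then have ln: "1 \<le> ln (real n)" using n by (simp add: ln_ge_iff)
      have "0 < ln (2 :: real)" "ln (2 :: real) \<le> 1" using ln_le_minus_one[of 2] by auto
      then have "ln (real n) * 1 \<le> ln (real n) * (1 / ln 2)" using ln by (intro mult_left_mono) auto
      then show "1 * norm (ln (real n)) \<le> norm (?X n) \<and> norm (?X n) \<le> (1 + 1 / ln 2) * norm (ln (real n))"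
        using ln unfolding log_def by (simp add: algebra_simps)
    qed
  qed (auto intro: add_pos_pos)
  have 2: "online_coloring_algorithm (bipartite_graphs :: 'v graph set) ?A \<and>
      ratio_guarantee (bipartite_graphs :: 'v graph set) (\<lambda>G. ?X (card (verts G))) ?A"
  proof (rule main)
    show "1 \<le> ?X (card (verts G))" if "G \<in> bipartite_graphs" for G :: "'v graph"
    proof -
      have "1 \<le> card (verts G)"
        using that by (auto simp: bipartite_graphs_def finite_graph_def Suc_le_eq card_gt_0_iff)
      then show ?thesis by simp
    qed
  qed (use card_bicolor_log in blast)+
  have 3: "online_coloring_algorithm (path_free_bipartite_graphs 6 :: 'v graph set) ?A \<and>
      ratio_guarantee (path_free_bipartite_graphs 6 :: 'v graph set) P6_free_value ?A"
  proof (rule main[OF sub])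
    show "1 \<le> P6_free_value G" if "G \<in> path_free_bipartite_graphs 6" for G :: "'v graph"
      using pf(4)[OF that] by (cases "edges G = {}") (simp_all add: P6_free_value_def)
    show "real (card (bicolor (arrival_graph G \<pi>) ` {..<length \<pi>})) \<le> 4 * P6_free_value G"
      if "G \<in> path_free_bipartite_graphs 6" "edges G \<noteq> {}" "\<pi> \<in> permutations_of_set (verts G)" for G :: "'v graph" and \<pi>
      using card_bicolor_P6_free[OF pf(1,2)[OF that(1)] that(3)] that(2) by (simp add: P6_free_value_def)
  qed
  have 4: "online_coloring_algorithm (path_free_bipartite_graphs 7 :: 'v graph set) ?A \<and>
      ratio_guarantee (path_free_bipartite_graphs 7 :: 'v graph set) (\<lambda>G. 2 * real (online_chromatic_number G) - 1 / 2) ?A"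
  proof (rule main[OF sub])
    show "1 \<le> 2 * real (online_chromatic_number G) - 1 / 2" if "G \<in> path_free_bipartite_graphs 7" for G :: "'v graph"
      using pf(3)[OF that] by linarith
  qed (use pf card_bicolor_P7_free in blast)
  have 5: "online_coloring_algorithm (path_free_bipartite_graphs 8 :: 'v graph set) ?A \<and>
      ratio_guarantee (path_free_bipartite_graphs 8 :: 'v graph set)
        (\<lambda>G. 3 * (real (online_chromatic_number G) + 1)\<^sup>2 / 2) ?A"
  proof (rule main[OF sub])
    show "1 \<le> 3 * (real (online_chromatic_number G) + 1)\<^sup>2 / 2" if "G \<in> path_free_bipartite_graphs 8" for G :: "'v graph"
      using sq[OF that] by linarith
    show "real (card (bicolor (arrival_graph G \<pi>) ` {..<length \<pi>})) \<le> 4 * (3 * (real (online_chromatic_number G) + 1)\<^sup>2 / 2)"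
      if "G \<in> path_free_bipartite_graphs 8" "\<pi> \<in> permutations_of_set (verts G)" for G :: "'v graph" and \<pi>
      using card_bicolor_P9_free[OF pf(1,2)[OF that(1)] _ _ that(2)] by simp
  qed
  have 6: "online_coloring_algorithm (path_free_bipartite_graphs 9 :: 'v graph set) ?A \<and>
      ratio_guarantee (path_free_bipartite_graphs 9 :: 'v graph set)
        (\<lambda>G. 3 * (real (online_chromatic_number G) + 1)\<^sup>2) ?A"
  proof (rule main[OF sub])
    show "1 \<le> 3 * (real (online_chromatic_number G) + 1)\<^sup>2" if "G \<in> path_free_bipartite_graphs 9" for G :: "'v graph"
      using sq[OF that] by linarith
    show "real (card (bicolor (arrival_graph G \<pi>) ` {..<length \<pi>})) \<le> 4 * (3 * (real (online_chromatic_number G) + 1)\<^sup>2)"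
      if "G \<in> path_free_bipartite_graphs 9" "\<pi> \<in> permutations_of_set (verts G)" for G :: "'v graph" and \<pi>
      using card_bicolor_P9_free[OF pf(1,2)[OF that(1)] _ _ that(2)] sq[OF that(1)] by simp
  qed
  show ?thesis
    by (intro conjI exI[of _ ?X] exI[of _ ?A] 1 conjunct1[OF 2] conjunct2[OF 2] conjunct1[OF 3] conjunct2[OF 3]
        conjunct1[OF 4] conjunct2[OF 4] conjunct1[OF 5] conjunct2[OF 5] conjunct1[OF 6] conjunct2[OF 6])
qed

end
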